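(* Let $H_1,H_2$ be complex Hilbert spaces, let $T \in \overline{\mathcal{AM}(H_1, H_2)}$ and let $T = W|T|$ be the polar decomposition of $T$. Then $T = \beta W + K$ for some compact operator $K \in \mathcal{K}(H_1, H_2)$ and some real number $\beta \geq 0$.
   Context: Hilbert spaces are complex, of arbitrary dimension. $\mathcal{B}(H_1,H_2)$ is the space of bounded linear operators with the operator norm, $\mathcal{K}(H_1,H_2)$ the set of compact operators, and $\overline{\mathcal{A}}$ the closure of $\mathcal{A}\subseteq\mathcal{B}(H_1,H_2)$ in the operator norm. $T\in\mathcal{B}(H_1,H_2)$ is minimum attaining if there is $x\in H_1$ with $\|x\|=1$ and $\|Tx\|=m(T)$, where $m(T)=\inf\{\|Tx\|:x\in H_1,\|x\|=1\}$. $T$ is absolutely minimum attaining (an $\mathcal{AM}$-operator) if for every nonzero closed subspace $M$ of $H_1$ the restriction $T|_M:M\to H_2$ is minimum attaining; $\mathcal{AM}(H_1,H_2)$ is the set of such operators. $|T|=(T^*T)^{1/2}$, and the polar decomposition of $T$ is $T=W|T|$ with $W\in\mathcal{B}(H_1,H_2)$ the unique partial isometry satisfying $T=W|T|$ and $N(W)=N(T)$ ($N(\cdot)$ is the null space). *)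

theory Defs
  imports "HOL-Analysis.Analysis"
begin

text \<open>
  Complex Hilbert spaces are obtained by enriching the library's real inner product spaces, so that
  norm, topology and the type of bounded linear maps are those of HOL-Analysis. The inner product
  is linear in the first argument; positive definiteness is inherited from
  \<open>inner x x = Re (cinner x x)\<close>. The zero space is not excluded.
\<close>

class complex_inner = real_inner +
  fixes scaleC :: "complex \<Rightarrow> 'a \<Rightarrow> 'a"  (infixr "*\<^sub>C" 75)
    and cinner :: "'a \<Rightarrow> 'a \<Rightarrow> complex"
  assumes scaleC_add_right: "a *\<^sub>C (x + y) = a *\<^sub>C x + a *\<^sub>C y"
    and scaleC_add_left: "(a + b) *\<^sub>C x = a *\<^sub>C x + b *\<^sub>C x"
    and scaleC_scaleC: "a *\<^sub>C (b *\<^sub>C x) = (a * b) *\<^sub>C x"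
    and scaleC_of_real: "complex_of_real r *\<^sub>C x = r *\<^sub>R x"
    and cinner_commute: "cinner x y = cnj (cinner y x)"
    and cinner_add_left: "cinner (x + y) z = cinner x z + cinner y z"
    and cinner_scaleC_left: "cinner (a *\<^sub>C x) y = a * cinner x y"
    and inner_eq_Re_cinner: "inner x y = Re (cinner x y)"

class chilbert_space = complex_inner + complete_space

definition csubspace :: "'a::complex_inner set \<Rightarrow> bool" where
  "csubspace M \<longleftrightarrow>
     0 \<in> M \<and> (\<forall>x\<in>M. \<forall>y\<in>M. x + y \<in> M) \<and> (\<forall>c. \<forall>x\<in>M. c *\<^sub>C x \<in> M)"

text \<open>
  The type \<open>'a \<Rightarrow>\<^sub>L 'b\<close> consists of the bounded real-linear maps; the complex-linear
  ones form a closed subset, so closures in the operator norm may be taken in \<open>'a \<Rightarrow>\<^sub>L 'b\<close>.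
\<close>

definition bounded_ops :: "('a::complex_inner \<Rightarrow>\<^sub>L 'b::complex_inner) set" where
  "bounded_ops = {T. \<forall>c x. blinfun_apply T (c *\<^sub>C x) = c *\<^sub>C blinfun_apply T x}"

definition null_space :: "('a::complex_inner \<Rightarrow>\<^sub>L 'b::complex_inner) \<Rightarrow> 'a set" where
  "null_space T = {x. blinfun_apply T x = 0}"

definition compact_ops :: "('a::complex_inner \<Rightarrow>\<^sub>L 'b::complex_inner) set" where
  "compact_ops = {K \<in> bounded_ops. compact (closure (blinfun_apply K ` cball 0 1))}"

text \<open>The quantity \<open>m\<close> and minimum attainment for the restriction of \<open>T\<close> to \<open>M\<close>.\<close>

definition min_modulus_on ::
    "'a::complex_inner set \<Rightarrow> ('a \<Rightarrow>\<^sub>L 'b::complex_inner) \<Rightarrow> real" where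
  "min_modulus_on M T = Inf {norm (blinfun_apply T x) | x. x \<in> M \<and> norm x = 1}"

definition minimum_attaining_on ::
    "'a::complex_inner set \<Rightarrow> ('a \<Rightarrow>\<^sub>L 'b::complex_inner) \<Rightarrow> bool" where
  "minimum_attaining_on M T \<longleftrightarrow>
     (\<exists>x\<in>M. norm x = 1 \<and> norm (blinfun_apply T x) = min_modulus_on M T)"

definition AM_ops :: "('a::complex_inner \<Rightarrow>\<^sub>L 'b::complex_inner) set" where
  "AM_ops = {T \<in> bounded_ops.
     \<forall>M. csubspace M \<and> closed M \<and> M \<noteq> {0} \<longrightarrow> minimum_attaining_on M T}"

definition cadjoint ::
    "('a::chilbert_space \<Rightarrow>\<^sub>L 'b::chilbert_space) \<Rightarrow> ('b \<Rightarrow>\<^sub>L 'a)" where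
  "cadjoint T = (THE S. S \<in> bounded_ops \<and>
     (\<forall>x y. cinner (blinfun_apply T x) y = cinner x (blinfun_apply S y)))"

definition positive_op :: "('a::chilbert_space \<Rightarrow>\<^sub>L 'a) \<Rightarrow> bool" where
  "positive_op A \<longleftrightarrow> A \<in> bounded_ops \<and>
     (\<forall>x. cinner (blinfun_apply A x) x \<in> \<real> \<and> 0 \<le> Re (cinner (blinfun_apply A x) x))"

definition op_sqrt :: "('a::chilbert_space \<Rightarrow>\<^sub>L 'a) \<Rightarrow> ('a \<Rightarrow>\<^sub>L 'a)" where
  "op_sqrt B = (THE A. positive_op A \<and> A o\<^sub>L A = B)"

definition op_abs :: "('a::chilbert_space \<Rightarrow>\<^sub>L 'b::chilbert_space) \<Rightarrow> ('a \<Rightarrow>\<^sub>L 'a)" where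
  "op_abs T = op_sqrt (cadjoint T o\<^sub>L T)"

definition partial_isometry :: "('a::chilbert_space \<Rightarrow>\<^sub>L 'b::chilbert_space) \<Rightarrow> bool" where
  "partial_isometry W \<longleftrightarrow> W \<in> bounded_ops \<and>
     (\<forall>x. (\<forall>z \<in> null_space W. cinner x z = 0) \<longrightarrow> norm (blinfun_apply W x) = norm x)"

text \<open>\<open>T = W |T|\<close> is the polar decomposition of \<open>T\<close>.\<close>

definition polar_decomposition ::
    "('a::chilbert_space \<Rightarrow>\<^sub>L 'b::chilbert_space) \<Rightarrow> ('a \<Rightarrow>\<^sub>L 'b) \<Rightarrow> bool" where
  "polar_decomposition T W \<longleftrightarrow>
     partial_isometry W \<and> T = W o\<^sub>L op_abs T \<and> null_space W = null_space T"

end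

theory Submission imports Defs begin

text \<open>
  Let \<open>q(x) = \<parallel>Tx\<parallel>\<^sup>2\<close> on unit vectors. If \<open>T\<close> is absolutely minimum attaining, \<open>q\<close>
  cannot take values \<open>\<le> c\<close> and values \<open>\<ge> d > c\<close> on the orthogonal complement of every finite
  set: mixing such vectors gives orthonormal \<open>e\<^sub>n\<close>, with orthogonal images, such that
  \<open>q(e\<^sub>n)\<close> decreases strictly to \<open>c\<close>, and the minimum is not attained on their closed span.
  This obstruction survives norm limits. Hence, for \<open>T\<close> in the closure, there is \<open>\<beta> \<ge> 0\<close> such that
  \<open>q\<close> is within \<open>\<epsilon>\<close> of \<open>\<beta>\<^sup>2\<close> off a finite set, for each \<open>\<epsilon> > 0\<close>. Then \<open>|T|\<^sup>2 - \<beta>\<^sup>2\<close>, and with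
  it \<open>|T| - \<beta>\<close>, is small in norm off finite sets, hence compact, and
  \<open>T - \<beta> W = W (|T| - \<beta>)\<close>.

  Orthogonality is meant with respect to the real inner product; complex orthogonality to \<open>f\<close> is real
  orthogonality to \<open>f\<close> and \<open>\<i> f\<close>.
\<close>

text \<open>Completeness of the operator space, for the square root iteration, and compactness by
  total boundedness are both available for \<open>banach\<close>.\<close>

instance chilbert_space \<subseteq> banach ..

section \<open>Complex scalar multiplication in terms of the real structure\<close>

lemma cinner_scaleC_right: "cinner x (a *\<^sub>C y) = cnj a * cinner x y"
  for x :: "'a::complex_inner"
  by (metis cinner_commute cinner_scaleC_left complex_cnj_mult)

lemma scaleC_scaleR: "a *\<^sub>C (r *\<^sub>R x) = r *\<^sub>R (a *\<^sub>C x)" for x :: "'a::complex_inner"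
  by (metis mult.commute scaleC_of_real scaleC_scaleC)

lemma scaleC_i_i [simp]: "\<i> *\<^sub>C \<i> *\<^sub>C x = - x" for x :: "'a::complex_inner"
  using scaleC_of_real[of "-1" x] by (simp add: scaleC_scaleC)

lemma scaleC_decompose: "c *\<^sub>C x = Re c *\<^sub>R x + Im c *\<^sub>R (\<i> *\<^sub>C x)"
  for x :: "'a::complex_inner"
proof -
  have "c *\<^sub>C x = (of_real (Re c) + of_real (Im c) * \<i>) *\<^sub>C x"
    by (metis complex_eq mult.commute)
  then show ?thesis
    by (simp add: scaleC_add_left scaleC_of_real flip: scaleC_scaleC)
qed

lemma Im_cinner: "Im (cinner x y) = inner x (\<i> *\<^sub>C y)" for x :: "'a::complex_inner"
  by (simp add: inner_eq_Re_cinner cinner_scaleC_right)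

text \<open>By \<open>Im_cinner\<close>, real and imaginary parts are both real inner products, so
  complex identities reduce to real ones.\<close>

lemma cinner_eqI:
  fixes x y :: "'a::complex_inner" and u v :: "'b::complex_inner"
  assumes "inner x y = inner u v" and "inner x (\<i> *\<^sub>C y) = inner u (\<i> *\<^sub>C v)"
  shows "cinner x y = cinner u v"
  using assms by (simp add: complex_eq_iff Im_cinner) (simp add: inner_eq_Re_cinner)

lemma inner_i_i: "inner (\<i> *\<^sub>C x) (\<i> *\<^sub>C y) = inner x y" for x :: "'a::complex_inner"
  by (simp add: inner_eq_Re_cinner cinner_scaleC_right cinner_scaleC_left)

lemma inner_i_left: "inner (\<i> *\<^sub>C x) y = - inner x (\<i> *\<^sub>C y)" for x :: "'a::complex_inner"
  by (simp add: inner_eq_Re_cinner cinner_scaleC_right cinner_scaleC_left)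

lemma inner_i_self: "inner x (\<i> *\<^sub>C x) = 0" for x :: "'a::complex_inner"
  using inner_i_left[of x x] by (simp add: inner_commute)

lemma bounded_linear_i: "bounded_linear (\<lambda>x::'a::complex_inner. \<i> *\<^sub>C x)"
proof (rule bounded_linear_intro[where K = 1])
  show "norm (\<i> *\<^sub>C x) \<le> norm x * 1" for x :: 'a
    by (simp add: norm_eq_sqrt_inner inner_i_i)
qed (simp_all add: scaleC_add_right scaleC_scaleR)

text \<open>Real linearity is built into the type, so \<open>scaleC_decompose\<close> leaves only
  commutation with \<open>\<i>\<close> to be checked.\<close>

lemma bounded_ops_iff:
  "T \<in> bounded_ops \<longleftrightarrow> (\<forall>x. blinfun_apply T (\<i> *\<^sub>C x) = \<i> *\<^sub>C blinfun_apply T x)"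
proof
  assume R: "\<forall>x. blinfun_apply T (\<i> *\<^sub>C x) = \<i> *\<^sub>C blinfun_apply T x"
  have "blinfun_apply T (c *\<^sub>C x) = c *\<^sub>C blinfun_apply T x" for c x
    using R by (simp add: scaleC_decompose[of c] blinfun.bilinear_simps)
  then show "T \<in> bounded_ops" by (simp add: bounded_ops_def)
qed (simp add: bounded_ops_def)

lemma bounded_opsD: "T \<in> bounded_ops \<Longrightarrow> blinfun_apply T (\<i> *\<^sub>C x) = \<i> *\<^sub>C blinfun_apply T x"
  by (simp add: bounded_ops_iff)

lemma closed_bounded_ops: "closed (bounded_ops :: ('a::complex_inner \<Rightarrow>\<^sub>L 'b::complex_inner) set)"
proof -
  have eq: "bounded_ops = (\<Inter>x. {T :: 'a \<Rightarrow>\<^sub>L 'b.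
      blinfun_apply T (\<i> *\<^sub>C x) = \<i> *\<^sub>C blinfun_apply T x})"
    by (auto simp: bounded_ops_iff)
  show ?thesis
    unfolding eq
    by (intro closed_INT ballI closed_Collect_eq continuous_intros
        bounded_linear.continuous_on[OF bounded_linear_i])
qed

lemma bounded_ops_closure:
  assumes "A \<subseteq> bounded_ops" "T \<in> closure A" shows "T \<in> bounded_ops"
  using assms closed_bounded_ops closure_minimal by blast

lemma bounded_ops_diff: "S \<in> bounded_ops \<Longrightarrow> T \<in> bounded_ops \<Longrightarrow> S - T \<in> bounded_ops"
  by (simp add: bounded_ops_iff blinfun.bilinear_simps
      linear_diff[OF bounded_linear.linear[OF bounded_linear_i]])

lemma bounded_ops_add: "S \<in> bounded_ops \<Longrightarrow> T \<in> bounded_ops \<Longrightarrow> S + T \<in> bounded_ops"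
  by (simp add: bounded_ops_iff blinfun.bilinear_simps scaleC_add_right)

lemma bounded_ops_scaleR: "S \<in> bounded_ops \<Longrightarrow> r *\<^sub>R S \<in> bounded_ops"
  by (simp add: bounded_ops_iff blinfun.bilinear_simps scaleC_scaleR)

lemma bounded_ops_compose: "S \<in> bounded_ops \<Longrightarrow> T \<in> bounded_ops \<Longrightarrow> S o\<^sub>L T \<in> bounded_ops"
  by (simp add: bounded_ops_iff)

lemma bounded_ops_id: "id_blinfun \<in> bounded_ops"
  by (simp add: bounded_ops_iff)

section \<open>Adjoints\<close>

lemma eq_if_inner_eq:
  fixes x y :: "'a::real_inner" assumes "\<And>z. inner z x = inner z y" shows "x = y"
proof -
  have "inner (x - y) (x - y) = 0" using assms[of "x - y"] by (simp only: inner_diff_right)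
  then show ?thesis by simp
qed

lemma norm_diff_scaleR_square:
  "(norm (x - r *\<^sub>R y))\<^sup>2 = (norm x)\<^sup>2 - 2 * r * inner y x + r\<^sup>2 * (norm y)\<^sup>2"
  for x :: "'a::real_inner"
  unfolding power2_norm_eq_inner
  by (simp add: inner_diff inner_commute) (simp add: power2_eq_square algebra_simps)

text \<open>First-order condition at a minimum: for small \<open>t\<close> of sign opposite to
  \<open>a\<close> the linear term dominates. It serves both the Riesz minimizer and isotropic
  vectors of a semidefinite form.\<close>

lemma linear_coeff_zero:
  fixes a b :: real
  assumes "\<And>t. 0 \<le> t * a + t\<^sup>2 * b" shows "a = 0"
proof (rule ccontr)
  assume a: "a \<noteq> 0"
  \<comment> \<open>At \<open>t = - (a / c)\<close> the sum is
    \<open>(a / c)\<^sup>2 * (b - c)\<close>; the added 1 ensures both \<open>c > 0\<close> and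
    \<open>b < c\<close>.\<close>
  define c where "c = \<bar>b\<bar> + 1"
  have c: "c > 0" "b < c" by (auto simp: c_def)
  have "0 \<le> (- (a / c)) * a + (- (a / c))\<^sup>2 * b" by (rule assms)
  also have "\<dots> = (a / c)\<^sup>2 * (b - c)"
    using c by (simp add: field_simps power2_eq_square)
  also have "\<dots> < 0" using a c by (intro mult_pos_neg) auto
  finally show False by simp
qed

text \<open>The representing vector is the minimizer of \<open>\<parallel>x\<parallel>\<^sup>2 / 2 - f x\<close>;
  minimizing sequences are Cauchy by the parallelogram law.\<close>

lemma riesz_representation:
  fixes f :: "'a::{real_inner,complete_space} \<Rightarrow> real"
  assumes "bounded_linear f"
  shows "\<exists>z. \<forall>x. f x = inner x z"
proof -
  interpret f: bounded_linear f by (rule assms)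
  define g where "g x = (norm x)\<^sup>2 / 2 - f x" for x
  obtain C where C: "\<And>x. norm (f x) \<le> norm x * C" using f.bounded by blast
  have lower: "- (C\<^sup>2 / 2) \<le> g x" for x
  proof -
    have "f x \<le> norm x * C" using C[of x] by auto
    moreover have "0 \<le> (norm x - C)\<^sup>2" by simp
    ultimately show ?thesis by (simp add: g_def power2_eq_square algebra_simps)
  qed
  define m where "m = Inf (range g)"
  have bdd: "bdd_below (range g)" using lower by (intro bdd_belowI[of _ "- (C\<^sup>2 / 2)"]) auto
  have m_le: "m \<le> g x" for x unfolding m_def using bdd by (simp add: cInf_lower)
  have "\<exists>x. g x < m + inverse (Suc n)" for n
    using cInf_lessD[of "range g" "m + inverse (Suc n)"] by (auto simp: m_def)
  then obtain X where X: "\<And>n. g (X n) < m + inverse (Suc n)" by metis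
  \<comment> \<open>The linear term \<open>f\<close> cancels against the midpoint, so only norms
    remain.\<close>
  have par: "g x + g y - 2 * g ((1/2) *\<^sub>R (x + y)) = (norm (x - y))\<^sup>2 / 4" for x y
    by (simp add: g_def f.scaleR f.add power2_norm_eq_inner inner_add inner_diff
        inner_commute field_simps)
  have dist: "(norm (X n - X k))\<^sup>2 < 4 * (inverse (Suc n) + inverse (Suc k))" for n k
    using par[of "X n" "X k"] X[of n] X[of k] m_le[of "(1/2) *\<^sub>R (X n + X k)"] by simp
  have "Cauchy X"
  proof (rule CauchyI)
    fix e :: real assume e: "0 < e"
    \<comment> \<open>Both inverses end up below \<open>e\<^sup>2 / 8\<close>, so four times their
      sum is below \<open>e\<^sup>2\<close>.\<close>
    obtain N where N: "inverse (Suc N) < e\<^sup>2 / 8"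
      using reals_Archimedean[of "e\<^sup>2 / 8"] e by auto
    have "norm (X n - X k) < e" if "n \<ge> N" "k \<ge> N" for n k
    proof -
      have "inverse (Suc n) \<le> inverse (real (Suc N))" "inverse (Suc k) \<le> inverse (real (Suc N))"
        using that by (auto intro!: le_imp_inverse_le)
      moreover have "4 * (a + b) < d" if "a \<le> c" "b \<le> c" "c < d / 8" for a b c d :: real
        using that by simp
      ultimately have "(norm (X n - X k))\<^sup>2 < e\<^sup>2"
        using dist[of n k] N less_trans by blast
      then show ?thesis using e by (simp add: power_less_imp_less_base)
    qed
    then show "\<exists>M. \<forall>m\<ge>M. \<forall>n\<ge>M. norm (X m - X n) < e" by blast
  qed
  then obtain z where z: "X \<longlonglongrightarrow> z" using Cauchy_convergent convergent_def by blast
  have "(\<lambda>n. g (X n)) \<longlonglongrightarrow> g z" unfolding g_def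
    by (intro tendsto_intros z f.tendsto) simp
  moreover have "(\<lambda>n. m + inverse (real (Suc n))) \<longlonglongrightarrow> m + 0"
    by (intro tendsto_intros LIMSEQ_inverse_real_of_nat)
  ultimately have "g z \<le> m + 0"
    by (rule LIMSEQ_le) (use X less_imp_le in blast)
  then have gz: "g z \<le> m" by simp
  have min: "inner h z - f h = 0" for h
  proof (rule linear_coeff_zero)
    fix t
    have "0 \<le> g (z + t *\<^sub>R h) - g z" using gz m_le[of "z + t *\<^sub>R h"] by simp
    also have "\<dots> = t * (inner h z - f h) + t\<^sup>2 * ((norm h)\<^sup>2 / 2)"
      using norm_diff_scaleR_square[of z "- t" h] by (simp add: g_def f.scaleR f.add field_simps)
    finally show "0 \<le> t * (inner h z - f h) + t\<^sup>2 * ((norm h)\<^sup>2 / 2)" .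
  qed
  have "f h = inner h z" for h using min[of h] by simp
  then show ?thesis by blast
qed

text \<open>Riesz representation of \<open>inner (T x) y\<close> as a functional of
  \<open>x\<close>, for each \<open>y\<close>. Testing against all vectors gives linearity of
  \<open>S\<close>; testing against \<open>S y\<close> gives its bound.\<close>

lemma real_adjoint_exists:
  fixes T :: "'a::{real_inner,complete_space} \<Rightarrow>\<^sub>L 'b::real_inner"
  shows "\<exists>S :: 'b \<Rightarrow>\<^sub>L 'a. \<forall>x y. inner (blinfun_apply T x) y = inner x (blinfun_apply S y)"
proof -
  have "\<exists>z. \<forall>x. inner (blinfun_apply T x) y = inner x z" for y
    by (rule riesz_representation)
      (rule bounded_linear_compose[OF bounded_linear_inner_left blinfun.bounded_linear_right])
  then obtain S where S: "\<And>x y. inner (blinfun_apply T x) y = inner x (S y)" by metis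
  have "bounded_linear S"
  proof (rule bounded_linear_intro[where K = "norm T"])
    show "S (x + y) = S x + S y" for x y
      by (rule eq_if_inner_eq) (simp add: inner_add_right flip: S)
    show "S (r *\<^sub>R x) = r *\<^sub>R S x" for r x
      by (rule eq_if_inner_eq) (simp flip: S)
    show "norm (S y) \<le> norm y * norm T" for y
    proof (cases "S y = 0")
      case False
      have "norm (S y) * norm (S y) = inner (blinfun_apply T (S y)) y"
        by (simp add: S flip: power2_norm_eq_inner power2_eq_square)
      also have "\<dots> \<le> norm (blinfun_apply T (S y)) * norm y" by (rule norm_cauchy_schwarz)
      also have "\<dots> \<le> (norm T * norm (S y)) * norm y"
        by (intro mult_right_mono norm_blinfun) auto
      finally show ?thesis using False by (simp add: mult.commute mult.left_commute)
    qed auto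
  qed
  then show ?thesis by (intro exI[of _ "Blinfun S"]) (simp add: S bounded_linear_Blinfun_apply)
qed

text \<open>\<open>cadjoint\<close> is a definite description, so existence and uniqueness come
  first. Multiplication by \<open>\<i>\<close> is skew-symmetric for \<open>inner\<close>, hence the
  real adjoint of a complex-linear map is complex-linear and is the complex adjoint.\<close>

lemma cadjoint_props:
  fixes T :: "'a::chilbert_space \<Rightarrow>\<^sub>L 'b::chilbert_space"
  assumes T: "T \<in> bounded_ops"
  shows "cadjoint T \<in> bounded_ops"
    and "inner (blinfun_apply T x) y = inner x (blinfun_apply (cadjoint T) y)"
proof -
  define P where "P S \<longleftrightarrow> S \<in> bounded_ops \<and>
     (\<forall>x y. cinner (blinfun_apply T x) y = cinner x (blinfun_apply S y))" for S
  obtain S where S: "\<And>x y. inner (blinfun_apply T x) y = inner x (blinfun_apply S y)"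
    using real_adjoint_exists[of T] by blast
  have Sb: "S \<in> bounded_ops"
    unfolding bounded_ops_iff
  proof
    fix y
    have "inner z (blinfun_apply S (\<i> *\<^sub>C y)) = inner z (\<i> *\<^sub>C blinfun_apply S y)" for z
      using inner_i_left[of "blinfun_apply T z" y] inner_i_left[of z "blinfun_apply S y"]
      by (simp add: bounded_opsD[OF T, symmetric] S)
    then show "blinfun_apply S (\<i> *\<^sub>C y) = \<i> *\<^sub>C blinfun_apply S y" by (rule eq_if_inner_eq)
  qed
  have PS: "P S"
    unfolding P_def by (auto intro!: cinner_eqI simp: S Sb bounded_opsD[OF Sb])
  have "R = S" if "P R" for R
  proof (rule blinfun_eqI, rule eq_if_inner_eq)
    fix y z
    show "inner z (blinfun_apply R y) = inner z (blinfun_apply S y)"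
      using that PS unfolding P_def inner_eq_Re_cinner by metis
  qed
  with PS have "P (THE S. P S)" by (rule theI[of P])
  moreover have "(THE S. P S) = cadjoint T" by (simp add: P_def cadjoint_def)
  ultimately have *: "P (cadjoint T)" by simp
  show "cadjoint T \<in> bounded_ops" using * by (simp add: P_def)
  show "inner (blinfun_apply T x) y = inner x (blinfun_apply (cadjoint T) y)"
    using * by (simp add: P_def inner_eq_Re_cinner)
qed

section \<open>Positive square roots\<close>

definition symmetric_op :: "('a::real_inner \<Rightarrow>\<^sub>L 'a) \<Rightarrow> bool" where
  "symmetric_op A \<longleftrightarrow> (\<forall>x y. inner (blinfun_apply A x) y = inner x (blinfun_apply A y))"

lemma symmetric_opD:
  "symmetric_op A \<Longrightarrow> inner (blinfun_apply A x) y = inner x (blinfun_apply A y)"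
  by (simp add: symmetric_op_def)

lemma closed_symmetric_op: "closed {A :: 'a::real_inner \<Rightarrow>\<^sub>L 'a. symmetric_op A}"
proof -
  have eq: "{A :: 'a \<Rightarrow>\<^sub>L 'a. symmetric_op A} = (\<Inter>x. \<Inter>y.
      {A. inner (blinfun_apply A x) y = inner x (blinfun_apply A y)})"
    by (auto simp: symmetric_op_def)
  show ?thesis
    unfolding eq by (intro closed_INT ballI closed_Collect_eq continuous_intros)
qed

text \<open>Real-valuedness of \<open>\<langle>Ax, x\<rangle>\<close> forces symmetry only over the complex
  numbers: test it on \<open>\<i> x + y\<close>.\<close>

lemma positive_op_symmetric:
  assumes "positive_op A" shows "symmetric_op A"
  unfolding symmetric_op_def
proof (intro allI)
  fix x y
  have A: "A \<in> bounded_ops" and im: "Im (cinner (blinfun_apply A z) z) = 0" for z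
    using assms by (auto simp: positive_op_def complex_is_Real_iff)
  have "inner (blinfun_apply A z) (\<i> *\<^sub>C z) = 0" for z using im[of z] by (simp add: Im_cinner)
  from this[of "\<i> *\<^sub>C x + y"] this[of "\<i> *\<^sub>C x"] this[of y]
  have "inner (\<i> *\<^sub>C blinfun_apply A x) (\<i> *\<^sub>C y) + inner (blinfun_apply A y) (\<i> *\<^sub>C \<i> *\<^sub>C x) = 0"
    by (simp add: blinfun.bilinear_simps scaleC_add_right inner_add inner_diff bounded_opsD[OF A])
  then show "inner (blinfun_apply A x) y = inner x (blinfun_apply A y)"
    by (simp add: inner_i_i inner_commute)
qed

text \<open>Symmetry and complex linearity make \<open>inner (A x) (\<i> *\<^sub>C x)\<close> equal
  to its own negative, so the quadratic form is real-valued.\<close>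

lemma positive_opI:
  assumes A: "A \<in> bounded_ops" and s: "symmetric_op A"
    and "\<And>x. 0 \<le> inner (blinfun_apply A x) x"
  shows "positive_op A"
  using assms inner_i_self symmetric_opD[OF s] bounded_opsD[OF A]
  unfolding positive_op_def
proof (intro conjI allI)
  fix x
  have "inner (blinfun_apply A x) (\<i> *\<^sub>C x) = 0"
    using symmetric_opD[OF s, of x "\<i> *\<^sub>C x"] inner_i_left[of "blinfun_apply A x" x]
    by (simp add: bounded_opsD[OF A]) (simp add: inner_commute)
  then show "cinner (blinfun_apply A x) x \<in> \<real>" by (simp add: complex_is_Real_iff Im_cinner)
qed (simp_all flip: inner_eq_Re_cinner)

lemma positive_op_inner: "positive_op A \<Longrightarrow> 0 \<le> inner (blinfun_apply A x) x"
  by (simp add: positive_op_def inner_eq_Re_cinner)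

text \<open>Expand \<open>\<langle>A(x - tAx), x - tAx\<rangle> \<ge> 0\<close> at \<open>t = 1 / b\<close>.\<close>

lemma positive_op_norm_le:
  assumes A: "positive_op A" and b: "norm A \<le> b" "0 < b"
  shows "(norm (blinfun_apply A x))\<^sup>2 \<le> b * inner (blinfun_apply A x) x"
proof -
  define y where "y = blinfun_apply A x"
  have s: "inner (blinfun_apply A y) x = (norm y)\<^sup>2"
    using symmetric_opD[OF positive_op_symmetric[OF A], of y x]
    by (simp add: y_def power2_norm_eq_inner)
  have "inner (blinfun_apply A y) y \<le> norm (blinfun_apply A y) * norm y"
    by (rule norm_cauchy_schwarz)
  also have "\<dots> \<le> (b * norm y) * norm y"
    using b by (intro mult_right_mono order_trans[OF norm_blinfun mult_right_mono]) auto
  finally have Ay: "inner (blinfun_apply A y) y \<le> b * (norm y)\<^sup>2" by (simp add: power2_eq_square)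
  define t where "t = 1 / b"
  have "0 \<le> inner (blinfun_apply A (x - t *\<^sub>R y)) (x - t *\<^sub>R y)" by (rule positive_op_inner[OF A])
  also have "\<dots> = inner y x - 2 * t * (norm y)\<^sup>2 + t\<^sup>2 * inner (blinfun_apply A y) y"
    by (simp add: blinfun.bilinear_simps inner_diff s power2_eq_square flip: y_def)
      (simp add: power2_norm_eq_inner flip: power2_eq_square,
        simp add: power2_eq_square algebra_simps)
  also have "\<dots> \<le> inner y x - 2 * t * (norm y)\<^sup>2 + t\<^sup>2 * (b * (norm y)\<^sup>2)"
    using Ay by (intro add_left_mono mult_left_mono) auto
  also have "\<dots> = inner y x - (norm y)\<^sup>2 / b"
    using b by (simp add: t_def field_simps power2_eq_square)
  finally show ?thesis using b by (simp add: y_def field_simps)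
qed

lemma positive_op_zero:
  assumes "positive_op A" "inner (blinfun_apply A x) x = 0" shows "blinfun_apply A x = 0"
  \<comment> \<open>The bound must be strictly positive, and \<open>norm A\<close> could be
    0.\<close>
  using positive_op_norm_le[OF assms(1), of "norm A + 1" x] assms(2)
    norm_ge_zero[of A] by (simp add: add_nonneg_pos)

section \<open>Iteration for positive square roots\<close>

fun sqrt_iter :: "('a::real_normed_vector \<Rightarrow>\<^sub>L 'a) \<Rightarrow> nat \<Rightarrow> ('a \<Rightarrow>\<^sub>L 'a)" where
  "sqrt_iter X 0 = 0"
| "sqrt_iter X (Suc n) = (1/2) *\<^sub>R (X + (sqrt_iter X n o\<^sub>L sqrt_iter X n))"

text \<open>The same recursion for the scalar 1 in place of \<open>X\<close>: an increasing sequence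
  in \<open>[0, 1]\<close> that majorizes the operator iterates and their increments when
  \<open>norm X \<le> 1\<close>.\<close>

fun sqrt_iter_bound :: "nat \<Rightarrow> real" where
  "sqrt_iter_bound 0 = 0"
| "sqrt_iter_bound (Suc n) = (1 + (sqrt_iter_bound n)\<^sup>2) / 2"

lemma sqrt_iter_bound_range: "0 \<le> sqrt_iter_bound n \<and> sqrt_iter_bound n \<le> 1"
  by (induction n) (auto simp: power_le_one)

lemma sqrt_iter_bound_mono: "sqrt_iter_bound n \<le> sqrt_iter_bound (Suc n)"
proof -
  have "0 \<le> (1 - sqrt_iter_bound n)\<^sup>2" by simp
  then show ?thesis by (simp add: power2_eq_square algebra_simps)
qed

lemmas blinfun_compose_simps =
  bounded_bilinear.add_left[OF bounded_bilinear_blinfun_compose]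
  bounded_bilinear.add_right[OF bounded_bilinear_blinfun_compose]
  bounded_bilinear.diff_left[OF bounded_bilinear_blinfun_compose]
  bounded_bilinear.diff_right[OF bounded_bilinear_blinfun_compose]
  bounded_bilinear.scaleR_left[OF bounded_bilinear_blinfun_compose]
  bounded_bilinear.scaleR_right[OF bounded_bilinear_blinfun_compose]
  bounded_bilinear.zero_left[OF bounded_bilinear_blinfun_compose]
  bounded_bilinear.zero_right[OF bounded_bilinear_blinfun_compose]

lemma blinfun_compose_assoc: "(A o\<^sub>L B) o\<^sub>L C = A o\<^sub>L (B o\<^sub>L C)"
  by (rule blinfun_eqI) simp

text \<open>The iterates are polynomials in \<open>X\<close>. For \<open>C\<close> an iterate, this
  makes iterates commute with each other; for general \<open>C\<close>, it passes to the limit and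
  gives the commutation behind uniqueness of the root.\<close>

lemma sqrt_iter_commute:
  assumes "C o\<^sub>L X = X o\<^sub>L C" shows "C o\<^sub>L sqrt_iter X n = sqrt_iter X n o\<^sub>L C"
proof (induction n)
  case (Suc n)
  have "C o\<^sub>L (sqrt_iter X n o\<^sub>L sqrt_iter X n) = (sqrt_iter X n o\<^sub>L sqrt_iter X n) o\<^sub>L C"
    using Suc by (metis blinfun_compose_assoc)
  then show ?case using assms by (simp add: blinfun_compose_simps)
qed (simp add: blinfun_compose_simps)

lemma sqrt_iter_norm:
  assumes "norm X \<le> 1" shows "norm (sqrt_iter X n) \<le> sqrt_iter_bound n"
proof (induction n)
  case (Suc n)
  have "norm (sqrt_iter X n o\<^sub>L sqrt_iter X n) \<le> sqrt_iter_bound n * sqrt_iter_bound n"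
    by (rule order_trans[OF norm_blinfun_compose mult_mono])
      (use Suc sqrt_iter_bound_range in auto)
  then show ?case
    using assms norm_triangle_ineq[of X "sqrt_iter X n o\<^sub>L sqrt_iter X n"]
    by (simp add: power2_eq_square)
qed simp

text \<open>Commuting iterates allow \<open>z\<^sup>2 - y\<^sup>2 = (z + y) (z - y)\<close>. Each
  factor is bounded by its scalar counterpart, and the scalar sequence satisfies the same
  factorization exactly.\<close>

lemma sqrt_iter_step:
  assumes X: "norm X \<le> 1"
  shows "norm (sqrt_iter X (Suc n) - sqrt_iter X n)
    \<le> sqrt_iter_bound (Suc n) - sqrt_iter_bound n"
proof (induction n)
  case 0
  then show ?case using X by (simp add: blinfun_compose_simps)
next
  case (Suc n)
  define y z where "y = sqrt_iter X n" and "z = sqrt_iter X (Suc n)"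
  have cXX: "sqrt_iter X n o\<^sub>L X = X o\<^sub>L sqrt_iter X n"
    by (rule sqrt_iter_commute[symmetric]) simp
  have c: "z o\<^sub>L y = y o\<^sub>L z"
    unfolding y_def z_def by (rule sqrt_iter_commute[OF cXX, symmetric])
  have "sqrt_iter X (Suc (Suc n)) - sqrt_iter X (Suc n)
      = (1/2) *\<^sub>R ((z o\<^sub>L z) - (y o\<^sub>L y))"
    unfolding sqrt_iter.simps(2)[of X "Suc n"] z_def[symmetric]
    by (simp add: z_def y_def scaleR_right_diff_distrib[symmetric])
  also have "(z o\<^sub>L z) - (y o\<^sub>L y) = (z + y) o\<^sub>L (z - y)"
    using c by (simp add: blinfun_compose_simps)
  finally have "norm (sqrt_iter X (Suc (Suc n)) - sqrt_iter X (Suc n))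
      = norm ((z + y) o\<^sub>L (z - y)) / 2" by simp
  also have "norm ((z + y) o\<^sub>L (z - y))
      \<le> (sqrt_iter_bound (Suc n) + sqrt_iter_bound n) * (sqrt_iter_bound (Suc n) - sqrt_iter_bound n)"
  proof (rule order_trans[OF norm_blinfun_compose mult_mono])
    show "norm (z + y) \<le> sqrt_iter_bound (Suc n) + sqrt_iter_bound n"
      unfolding y_def z_def by (intro norm_triangle_mono sqrt_iter_norm X)
    show "norm (z - y) \<le> sqrt_iter_bound (Suc n) - sqrt_iter_bound n"
      unfolding y_def z_def by (rule Suc.IH)
    show "0 \<le> sqrt_iter_bound (Suc n) + sqrt_iter_bound n"
      using sqrt_iter_bound_range[of n] sqrt_iter_bound_range[of "Suc n"] by linarith
  qed simp
  also have "(sqrt_iter_bound (Suc n) + sqrt_iter_bound n) * (sqrt_iter_bound (Suc n) - sqrt_iter_bound n) / 2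
      = sqrt_iter_bound (Suc (Suc n)) - sqrt_iter_bound (Suc n)"
    unfolding sqrt_iter_bound.simps(2)[of "Suc n"]
    using sqrt_iter_bound.simps(2)[of n]
    by (simp add: power2_eq_square field_simps del: sqrt_iter_bound.simps)
  finally show ?case by simp
qed

text \<open>The increment bounds telescope, so the Cauchy property is inherited from the bounded
  monotone scalar sequence.\<close>

lemma sqrt_iter_convergent:
  fixes X :: "'a::banach \<Rightarrow>\<^sub>L 'a"
  assumes X: "norm X \<le> 1"
  shows "convergent (sqrt_iter X)"
proof -
  have le: "norm (sqrt_iter X m - sqrt_iter X n) \<le> sqrt_iter_bound m - sqrt_iter_bound n"
    if "n \<le> m" for m n
    using that
  proof (induction m rule: dec_induct)
    case (step m)
    then show ?case
      using sqrt_iter_step[OF X, of m]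
        norm_triangle_ineq[of "sqrt_iter X (Suc m) - sqrt_iter X m" "sqrt_iter X m - sqrt_iter X n"]
      by (simp del: sqrt_iter.simps sqrt_iter_bound.simps)
  qed simp
  have "convergent sqrt_iter_bound"
    by (rule Bseq_mono_convergent)
      (use sqrt_iter_bound_range in \<open>auto intro!: BseqI'[of _ 1] lift_Suc_mono_le[of sqrt_iter_bound]
        sqrt_iter_bound_mono simp del: sqrt_iter_bound.simps\<close>)
  then have C: "Cauchy sqrt_iter_bound" by (rule convergent_Cauchy)
  have "Cauchy (sqrt_iter X)"
  proof (rule CauchyI)
    fix e :: real assume "0 < e"
    then obtain M where M: "\<And>m n. m \<ge> M \<Longrightarrow> n \<ge> M \<Longrightarrow> norm (sqrt_iter_bound m - sqrt_iter_bound n) < e"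
      using CauchyD[OF C] by metis
    have "norm (sqrt_iter X m - sqrt_iter X n) < e" if "m \<ge> M" "n \<ge> M" for m n
      using le[of m n] le[of n m] M[OF that] by (cases "m \<le> n") (auto simp: norm_minus_commute)
    then show "\<exists>M. \<forall>m\<ge>M. \<forall>n\<ge>M. norm (sqrt_iter X m - sqrt_iter X n) < e" by blast
  qed
  then show ?thesis by (simp add: Cauchy_convergent_iff)
qed

lemma sqrt_iter_symmetric: "symmetric_op X \<Longrightarrow> symmetric_op (sqrt_iter X n)"
  by (induction n) (simp_all add: symmetric_op_def blinfun.bilinear_simps inner_add)

lemma sqrt_iter_bounded_ops: "X \<in> bounded_ops \<Longrightarrow> sqrt_iter X n \<in> bounded_ops"
  by (induction n)
    (simp_all add: bounded_ops_scaleR bounded_ops_add bounded_ops_compose,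
      simp add: bounded_ops_iff linear_0[OF bounded_linear.linear[OF bounded_linear_i]])

text \<open>After normalizing \<open>X = 1 - B / s\<close> to a contraction, the limit \<open>Y\<close> of the iteration
  satisfies \<open>Y = (X + Y\<^sup>2) / 2\<close>, that is \<open>(1 - Y)\<^sup>2 = 1 - X\<close>.\<close>

lemma positive_sqrt_exists:
  assumes B: "positive_op B"
  shows "\<exists>A. positive_op A \<and> A o\<^sub>L A = B \<and> (\<forall>C. C o\<^sub>L B = B o\<^sub>L C \<longrightarrow> C o\<^sub>L A = A o\<^sub>L C)"
proof -
  define s where "s = norm B + 1"
  have s: "s > 0" "norm B \<le> s" by (auto simp: s_def add_nonneg_pos)
  define X where "X = id_blinfun - (1 / s) *\<^sub>R B"
  have Bb: "B \<in> bounded_ops" and Bs: "symmetric_op B"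
    using B positive_op_symmetric by (auto simp: positive_op_def)
  have Xs: "symmetric_op X"
    using symmetric_opD[OF Bs] by (simp add: symmetric_op_def X_def blinfun.bilinear_simps inner_diff)
  have Xb: "X \<in> bounded_ops"
    unfolding X_def by (intro bounded_ops_diff bounded_ops_scaleR bounded_ops_id Bb)
  \<comment> \<open>In the expansion of the square, \<open>positive_op_norm_le\<close> bounds the
    quadratic term by half of the negative cross term.\<close>
  have "norm X \<le> 1"
  proof (rule norm_blinfun_bound)
    fix x
    have "(norm (blinfun_apply X x))\<^sup>2
        = (norm x)\<^sup>2 - 2 / s * inner (blinfun_apply B x) x + (norm (blinfun_apply B x))\<^sup>2 / s\<^sup>2"
      using norm_diff_scaleR_square[of x "1 / s" "blinfun_apply B x"]
      by (simp add: X_def blinfun.bilinear_simps power_divide)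
    also have "\<dots> \<le> (norm x)\<^sup>2 - 2 / s * inner (blinfun_apply B x) x
        + (s * inner (blinfun_apply B x) x) / s\<^sup>2"
      by (intro add_left_mono divide_right_mono positive_op_norm_le[OF B]) (use s in auto)
    also have "\<dots> = (norm x)\<^sup>2 - inner (blinfun_apply B x) x / s"
      using s by (simp add: field_simps power2_eq_square)
    also have "\<dots> \<le> (norm x)\<^sup>2" using positive_op_inner[OF B] s by simp
    finally have "norm (blinfun_apply X x) \<le> norm x"
      by (rule power2_le_imp_le) simp
    then show "norm (blinfun_apply X x) \<le> 1 * norm x" by simp
  qed simp
  note X1 = this
  obtain Y where Y: "sqrt_iter X \<longlonglongrightarrow> Y"
    using sqrt_iter_convergent[OF X1] by (auto simp: convergent_def)
  have "(\<lambda>n. sqrt_iter X (Suc n)) \<longlonglongrightarrow> (1/2) *\<^sub>R (X + (Y o\<^sub>L Y))"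
    unfolding sqrt_iter.simps
    by (intro tendsto_intros bounded_bilinear.tendsto[OF bounded_bilinear_blinfun_compose] Y)
  then have Yeq: "Y = (1/2) *\<^sub>R (X + (Y o\<^sub>L Y))"
    using LIMSEQ_Suc[OF Y] LIMSEQ_unique by blast
  have "2 *\<^sub>R Y = 2 *\<^sub>R ((1/2) *\<^sub>R (X + (Y o\<^sub>L Y)))" using Yeq by metis
  then have YY: "Y o\<^sub>L Y = 2 *\<^sub>R Y - X" by simp
  have Ys: "symmetric_op Y"
    using closed_sequentially[OF closed_symmetric_op _ Y] sqrt_iter_symmetric[OF Xs] by auto
  have Yb: "Y \<in> bounded_ops"
    using closed_sequentially[OF closed_bounded_ops _ Y] sqrt_iter_bounded_ops[OF Xb] by auto
  have "norm (sqrt_iter X n) \<le> 1" for n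
    using sqrt_iter_norm[OF X1, of n] sqrt_iter_bound_range[of n] by linarith
  then have Y1: "norm Y \<le> 1"
    using closed_sequentially[OF closed_cball[of 0 1] _ Y] by auto
  \<comment> \<open>With \<open>1\<close> for the identity, \<open>1 - Y\<close> squares to
    \<open>1 - X = B / s\<close>; the factor \<open>sqrt s\<close> undoes the normalization.\<close>
  define A where "A = sqrt s *\<^sub>R (id_blinfun - Y)"
  have "positive_op A"
  proof (rule positive_opI)
    show "A \<in> bounded_ops"
      unfolding A_def by (intro bounded_ops_diff bounded_ops_scaleR bounded_ops_id Yb)
    show "symmetric_op A"
      using symmetric_opD[OF Ys] by (simp add: symmetric_op_def A_def blinfun.bilinear_simps inner_diff)
    fix x
    have "inner (blinfun_apply Y x) x \<le> norm (blinfun_apply Y x) * norm x"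
      by (rule norm_cauchy_schwarz)
    also have "\<dots> \<le> (1 * norm x) * norm x"
      using Y1 by (intro mult_right_mono order_trans[OF norm_blinfun mult_right_mono]) auto
    finally have "inner (blinfun_apply Y x) x \<le> inner x x" by (simp flip: power2_norm_eq_inner power2_eq_square)
    then show "0 \<le> inner (blinfun_apply A x) x"
      using s by (simp add: A_def blinfun.bilinear_simps inner_diff)
  qed
  moreover have "A o\<^sub>L A = B"
  proof (rule blinfun_eqI)
    fix x
    have "blinfun_apply Y (blinfun_apply Y x) = 2 *\<^sub>R blinfun_apply Y x - blinfun_apply X x"
      using arg_cong[OF YY, of "\<lambda>Z. blinfun_apply Z x"] by (simp add: blinfun.bilinear_simps)
    then have "blinfun_apply (A o\<^sub>L A) x = s *\<^sub>R (x - blinfun_apply X x)"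
      using s by (simp add: A_def blinfun.bilinear_simps scaleR_2 flip: scaleR_diff_right)
    also have "\<dots> = blinfun_apply B x"
      using s by (simp add: X_def blinfun.bilinear_simps)
    finally show "blinfun_apply (A o\<^sub>L A) x = blinfun_apply B x" .
  qed
  moreover have "C o\<^sub>L A = A o\<^sub>L C" if "C o\<^sub>L B = B o\<^sub>L C" for C
  proof -
    have id: "C o\<^sub>L id_blinfun = C" "id_blinfun o\<^sub>L C = C" by (auto intro: blinfun_eqI)
    have "C o\<^sub>L X = X o\<^sub>L C" using that by (simp add: X_def blinfun_compose_simps id)
    then have eq: "(\<lambda>n. C o\<^sub>L sqrt_iter X n) = (\<lambda>n. sqrt_iter X n o\<^sub>L C)"
      by (simp add: sqrt_iter_commute)
    have "(\<lambda>n. C o\<^sub>L sqrt_iter X n) \<longlonglongrightarrow> (C o\<^sub>L Y)"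
      by (intro bounded_bilinear.tendsto[OF bounded_bilinear_blinfun_compose] Y tendsto_const)
    moreover have "(\<lambda>n. sqrt_iter X n o\<^sub>L C) \<longlonglongrightarrow> (Y o\<^sub>L C)"
      by (intro bounded_bilinear.tendsto[OF bounded_bilinear_blinfun_compose] Y tendsto_const)
    ultimately have "C o\<^sub>L Y = Y o\<^sub>L C" unfolding eq by (rule LIMSEQ_unique)
    then show ?thesis by (simp add: A_def blinfun_compose_simps id)
  qed
  ultimately show ?thesis by blast
qed

text \<open>Uniqueness makes the definite description meaningful. Another root \<open>C\<close>
  commutes with its square \<open>B\<close>, hence with \<open>A\<close>, so
  \<open>(A + C) y = 0\<close> for \<open>y = (A - C) x\<close>. Positivity forces
  \<open>A y = C y = 0\<close>, and symmetry then gives \<open>inner y y = 0\<close>.\<close>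

lemma op_sqrt_props:
  assumes B: "positive_op B"
  shows "positive_op (op_sqrt B)" and "op_sqrt B o\<^sub>L op_sqrt B = B"
proof -
  obtain A where A: "positive_op A" "A o\<^sub>L A = B"
    and comm: "\<And>C. C o\<^sub>L B = B o\<^sub>L C \<Longrightarrow> C o\<^sub>L A = A o\<^sub>L C"
    using positive_sqrt_exists[OF B] by blast
  have unique: "C = A" if C: "positive_op C \<and> C o\<^sub>L C = B" for C
  proof (rule blinfun_eqI)
    fix x
    have CA: "C o\<^sub>L A = A o\<^sub>L C"
      using C by (intro comm) (metis blinfun_compose_assoc)
    define y where "y = blinfun_apply A x - blinfun_apply C x"
    have ACx: "blinfun_apply C (blinfun_apply A x) = blinfun_apply A (blinfun_apply C x)"
      using CA by (metis blinfun_apply_blinfun_compose)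
    have "blinfun_apply A (blinfun_apply A x) = blinfun_apply C (blinfun_apply C x)"
      using A(2) C by (metis blinfun_apply_blinfun_compose)
    then have "blinfun_apply A y + blinfun_apply C y = 0"
      by (simp add: y_def blinfun.bilinear_simps ACx)
    then have "inner (blinfun_apply A y) y + inner (blinfun_apply C y) y = 0"
      by (metis inner_add_left inner_zero_left)
    then have "inner (blinfun_apply A y) y = 0" "inner (blinfun_apply C y) y = 0"
      using positive_op_inner[of A y] positive_op_inner[of C y] A C by auto
    then have Ay: "blinfun_apply A y = 0" and Cy: "blinfun_apply C y = 0"
      using positive_op_zero A C by auto
    have "inner y y = inner (blinfun_apply A x) y - inner (blinfun_apply C x) y"
      by (simp add: y_def inner_diff_left)
    also have "\<dots> = 0"
      using A C by (simp add: symmetric_opD positive_op_symmetric Ay Cy)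
    finally show "blinfun_apply C x = blinfun_apply A x" by (simp add: y_def)
  qed
  have "op_sqrt B = A"
    unfolding op_sqrt_def by (rule the_equality) (use A in blast, rule unique)
  then show "positive_op (op_sqrt B)" and "op_sqrt B o\<^sub>L op_sqrt B = B" using A by simp_all
qed

text \<open>These are the only two facts about the modulus that the main argument uses.\<close>

lemma op_abs_props:
  assumes T: "T \<in> bounded_ops"
  shows "positive_op (op_abs T)" and "norm (blinfun_apply (op_abs T) x) = norm (blinfun_apply T x)"
proof -
  define B where "B = cadjoint T o\<^sub>L T"
  have B: "inner (blinfun_apply B x) y = inner (blinfun_apply T x) (blinfun_apply T y)" for x y
    using cadjoint_props(2)[OF T, of y "blinfun_apply T x"] by (simp add: B_def inner_commute)
  have pos: "positive_op B"
  proof (rule positive_opI)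
    show "B \<in> bounded_ops" unfolding B_def by (intro bounded_ops_compose cadjoint_props(1) T)
    show "symmetric_op B"
      unfolding symmetric_op_def by (metis B inner_commute)
  qed (simp add: B)
  show A: "positive_op (op_abs T)"
    using op_sqrt_props(1)[OF pos] by (simp add: op_abs_def B_def)
  have "inner (blinfun_apply (op_abs T) x) (blinfun_apply (op_abs T) x) = inner (blinfun_apply B x) x"
    using symmetric_opD[OF positive_op_symmetric[OF A], of "blinfun_apply (op_abs T) x" x]
      op_sqrt_props(2)[OF pos] by (metis B_def blinfun_apply_blinfun_compose op_abs_def)
  then show "norm (blinfun_apply (op_abs T) x) = norm (blinfun_apply T x)"
    by (simp add: norm_eq_sqrt_inner B)
qed

section \<open>Operators that are small on complements of finite sets\<close>

text \<open>Finite sets stand in for finite-dimensional subspaces, so neither orthogonal projections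
  nor finite-rank approximants have to be constructed.\<close>

definition small_off_finite :: "('a::real_inner \<Rightarrow>\<^sub>L 'b::real_normed_vector) \<Rightarrow> bool" where
  "small_off_finite K \<longleftrightarrow> (\<forall>\<epsilon>>0. \<exists>F. finite F \<and>
     (\<forall>x. (\<forall>f\<in>F. inner x f = 0) \<longrightarrow> norm (blinfun_apply K x) \<le> \<epsilon> * norm x))"

text \<open>Gram-Schmidt: the residual \<open>r\<close> is normalized and added unless it vanishes.
  Comparing annihilators takes the place of comparing spans.\<close>

lemma orthonormal_refinement:
  fixes F :: "'a::real_inner set"
  assumes "finite F"
  shows "\<exists>E. finite E \<and> (\<forall>e\<in>E. norm e = 1) \<and> (\<forall>e\<in>E. \<forall>e'\<in>E. e \<noteq> e' \<longrightarrow> inner e e' = 0) \<and>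
    (\<forall>x. (\<forall>e\<in>E. inner x e = 0) \<longrightarrow> (\<forall>f\<in>F. inner x f = 0))"
  using assms
proof (induction F)
  case (insert f F)
  then obtain E where E: "finite E" "\<forall>e\<in>E. norm e = 1" "\<forall>e\<in>E. \<forall>e'\<in>E. e \<noteq> e' \<longrightarrow> inner e e' = 0"
    and EF: "\<forall>x. (\<forall>e\<in>E. inner x e = 0) \<longrightarrow> (\<forall>f\<in>F. inner x f = 0)" by blast
  define r where "r = f - (\<Sum>e\<in>E. inner f e *\<^sub>R e)"
  have rE: "inner r e = 0" if "e \<in> E" for e
  proof -
    have "(\<Sum>e'\<in>E. inner f e' * inner e' e) = (\<Sum>e'\<in>E. if e' = e then inner f e else 0)"
      using E that by (intro sum.cong) (auto simp: simp flip: power2_norm_eq_inner)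
    then show ?thesis
      using E that by (simp add: r_def inner_diff_left inner_sum_left)
  qed
  have f: "inner x f = inner x r" if "\<forall>e\<in>E. inner x e = 0" for x
    using that by (simp add: r_def inner_diff_right inner_sum_right)
  show ?case
  proof (cases "r = 0")
    case True
    then show ?thesis using E EF f by (intro exI[of _ E]) auto
  next
    case False
    have xr: "inner x r = 0" if "inner x (r /\<^sub>R norm r) = 0" for x
      using that False by simp
    show ?thesis
      using E EF f False rE xr
      by (intro exI[of _ "insert (r /\<^sub>R norm r) E"]) (auto simp: inner_commute)
  qed
qed auto

text \<open>The combinations with coefficients in \<open>[-1, 1]\<close> form the image of a cube;
  it is built one coordinate at a time, as a sum with a compact segment.\<close>

lemma compact_combinations:
  fixes v :: "'i \<Rightarrow> 'b::real_normed_vector"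
  assumes "finite E"
  shows "\<exists>C. compact C \<and> (\<forall>c. (\<forall>e\<in>E. \<bar>c e\<bar> \<le> 1) \<longrightarrow> (\<Sum>e\<in>E. c e *\<^sub>R v e) \<in> C)"
  using assms
proof (induction E)
  case empty
  show ?case by (intro exI[of _ "{0}"]) auto
next
  case (insert i E)
  then obtain C where C: "compact C" "\<And>c. (\<forall>e\<in>E. \<bar>c e\<bar> \<le> 1) \<Longrightarrow> (\<Sum>e\<in>E. c e *\<^sub>R v e) \<in> C"
    by blast
  define I where "I = (\<lambda>t. t *\<^sub>R v i) ` {-1..1}"
  have "compact I"
    unfolding I_def by (intro compact_continuous_image continuous_intros) simp
  then have "compact {x + y |x y. x \<in> I \<and> y \<in> C}" using C(1) by (rule compact_sums)
  moreover have "(\<Sum>e\<in>insert i E. c e *\<^sub>R v e) \<in> {x + y |x y. x \<in> I \<and> y \<in> C}"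
    if c: "\<forall>e\<in>insert i E. \<bar>c e\<bar> \<le> 1" for c
  proof -
    have "c i *\<^sub>R v i \<in> I" using c by (auto simp: I_def abs_le_iff)
    then show ?thesis using C(2)[of c] c insert.hyps by auto
  qed
  ultimately show ?case by blast
qed

text \<open>Split \<open>x\<close> into its projection \<open>p\<close> onto the span of
  \<open>E\<close> and a remainder. \<open>K\<close> is small on the remainder, while
  \<open>K p\<close> stays in a compact set, which has a finite net.\<close>

lemma small_off_finite_compact:
  fixes K :: "'a::real_inner \<Rightarrow>\<^sub>L 'b::banach"
  assumes "small_off_finite K"
  shows "compact (closure (blinfun_apply K ` cball 0 1))"
  unfolding compact_eq_totally_bounded
proof (intro conjI allI impI)
  show "complete (closure (blinfun_apply K ` cball 0 1))" by (simp add: complete_eq_closed)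
  fix e :: real assume e: "e > 0"
  then obtain F where F: "finite F"
    and small: "\<And>x. (\<forall>f\<in>F. inner x f = 0) \<Longrightarrow> norm (blinfun_apply K x) \<le> (e/4) * norm x"
    using assms by (metis small_off_finite_def zero_less_divide_iff zero_less_numeral)
  obtain E where E: "finite E" "\<forall>e\<in>E. norm e = 1" "\<forall>e\<in>E. \<forall>e'\<in>E. e \<noteq> e' \<longrightarrow> inner e e' = 0"
    and EF: "\<And>x. (\<forall>e\<in>E. inner x e = 0) \<Longrightarrow> (\<forall>f\<in>F. inner x f = 0)"
    using orthonormal_refinement[OF F] by blast
  obtain C where C: "compact C"
    "\<And>c. (\<forall>e\<in>E. \<bar>c e\<bar> \<le> 1) \<Longrightarrow> (\<Sum>e\<in>E. c e *\<^sub>R blinfun_apply K e) \<in> C"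
    using compact_combinations[OF E(1)] by metis
  obtain k where k: "finite k" "C \<subseteq> (\<Union>x\<in>k. ball x (e/4))"
    using C(1) e unfolding compact_eq_totally_bounded by (metis zero_less_divide_iff zero_less_numeral)
  \<comment> \<open>Remainder and net contribute \<open>e/4\<close> each. Closed balls survive
    taking the closure and are enlarged to open balls of radius \<open>e\<close> only
    afterwards.\<close>
  have "blinfun_apply K ` cball 0 1 \<subseteq> (\<Union>x\<in>k. cball x (e/2))"
  proof
    fix y assume "y \<in> blinfun_apply K ` cball 0 1"
    then obtain x where x: "norm x \<le> 1" "y = blinfun_apply K x" by auto
    define p where "p = (\<Sum>e\<in>E. inner x e *\<^sub>R e)"
    have rE: "inner (x - p) e = 0" if "e \<in> E" for e
    proof -
      have "(\<Sum>e'\<in>E. inner x e' * inner e' e) = (\<Sum>e'\<in>E. if e' = e then inner x e else 0)"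
        using E that by (intro sum.cong) (auto simp flip: power2_norm_eq_inner)
      then show ?thesis
        using E that by (simp add: p_def inner_diff_left inner_sum_left)
    qed
    have "inner (x - p) p = 0"
      unfolding p_def inner_sum_right using rE by (simp flip: p_def)
    then have "(norm x)\<^sup>2 = (norm (x - p))\<^sup>2 + (norm p)\<^sup>2"
      using norm_add_Pythagorean[of "x - p" p] by (simp add: orthogonal_def)
    then have "(norm (x - p))\<^sup>2 \<le> (norm x)\<^sup>2" by simp
    then have "norm (x - p) \<le> 1" using x(1) by (meson norm_ge_zero order_trans power2_le_imp_le)
    then have "(e/4) * norm (x - p) \<le> (e/4) * 1" using e by (intro mult_left_mono) auto
    moreover have "norm (blinfun_apply K (x - p)) \<le> (e/4) * norm (x - p)"
      by (rule small, rule EF) (simp add: rE)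
    ultimately have "norm (blinfun_apply K (x - p)) \<le> e/4" by linarith
    then have d1: "dist (blinfun_apply K p) y \<le> e/4"
      by (simp add: x(2) dist_norm blinfun.bilinear_simps norm_minus_commute)
    have "\<bar>inner x e\<bar> \<le> 1" if "e \<in> E" for e
      using Cauchy_Schwarz_ineq2[of x e] E(2) that x(1) by auto
    then have "(\<Sum>e\<in>E. inner x e *\<^sub>R blinfun_apply K e) \<in> C" by (intro C(2)) auto
    then have "blinfun_apply K p \<in> C" by (simp add: p_def blinfun.bilinear_simps)
    then obtain z where z: "z \<in> k" "dist z (blinfun_apply K p) < e/4" using k(2) by auto
    have "dist z y \<le> e/2" using dist_triangle[of z y "blinfun_apply K p"] d1 z(2) by linarith
    then show "y \<in> (\<Union>x\<in>k. cball x (e/2))" using z(1) by auto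
  qed
  then have "closure (blinfun_apply K ` cball 0 1) \<subseteq> (\<Union>x\<in>k. cball x (e/2))"
    using k(1) by (intro closure_minimal closed_UN) auto
  also have "\<dots> \<subseteq> (\<Union>x\<in>k. ball x e)" using e by fastforce
  finally show "\<exists>k. finite k \<and> closure (blinfun_apply K ` cball 0 1) \<subseteq> (\<Union>x\<in>k. ball x e)"
    using k(1) by blast
qed

lemma small_off_finite_compose:
  assumes K: "small_off_finite K" shows "small_off_finite (W o\<^sub>L K)"
  unfolding small_off_finite_def
proof (intro allI impI)
  fix \<epsilon> :: real assume e: "\<epsilon> > 0"
  define c where "c = norm W + 1"
  have c: "c > 0" "norm W \<le> c" by (auto simp: c_def add_nonneg_pos)
  obtain F where F: "finite F"
    "\<And>x. (\<forall>f\<in>F. inner x f = 0) \<Longrightarrow> norm (blinfun_apply K x) \<le> (\<epsilon> / c) * norm x"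
    using K e c(1) unfolding small_off_finite_def by (metis divide_pos_pos)
  have "norm (blinfun_apply (W o\<^sub>L K) x) \<le> \<epsilon> * norm x" if "\<forall>f\<in>F. inner x f = 0" for x
  proof -
    have "norm (blinfun_apply W (blinfun_apply K x)) \<le> c * norm (blinfun_apply K x)"
      using c by (intro order_trans[OF norm_blinfun mult_right_mono]) auto
    also have "\<dots> \<le> c * ((\<epsilon> / c) * norm x)" using F(2)[OF that] c by (intro mult_left_mono) auto
    finally show ?thesis using c by simp
  qed
  then show "\<exists>F. finite F \<and> (\<forall>x. (\<forall>f\<in>F. inner x f = 0) \<longrightarrow> norm (blinfun_apply (W o\<^sub>L K) x) \<le> \<epsilon> * norm x)"
    using F(1) by blast
qed

section \<open>From quadratic forms to operators small off finite sets\<close>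

text \<open>Enlarging \<open>F\<close> by \<open>D ` F\<close> makes \<open>D x\<close> orthogonal to \<open>F\<close>, so that
  polarization bounds \<open>\<langle>Dx, Dx\<rangle>\<close>.\<close>

lemma symmetric_small_off_finite:
  assumes D: "symmetric_op D"
    and q: "\<And>\<epsilon>. \<epsilon> > 0 \<Longrightarrow> \<exists>F. finite F \<and>
      (\<forall>x. (\<forall>f\<in>F. inner x f = 0) \<longrightarrow> \<bar>inner (blinfun_apply D x) x\<bar> \<le> \<epsilon> * (norm x)\<^sup>2)"
  shows "small_off_finite D"
  unfolding small_off_finite_def
proof (intro allI impI)
  fix \<epsilon> :: real assume "\<epsilon> > 0"
  then obtain F where F: "finite F"
    "\<And>x. (\<forall>f\<in>F. inner x f = 0) \<Longrightarrow> \<bar>inner (blinfun_apply D x) x\<bar> \<le> \<epsilon> * (norm x)\<^sup>2"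
    using q by metis
  have "norm (blinfun_apply D x) \<le> \<epsilon> * norm x"
    if x: "\<forall>f\<in>F \<union> blinfun_apply D ` F. inner x f = 0" for x
  proof (cases "blinfun_apply D x = 0")
    case True
    then show ?thesis using \<open>\<epsilon> > 0\<close> by simp
  next
    case False
    define y where "y = blinfun_apply D x"
    define a b where "a = norm x" and "b = norm y"
    have x0: "x \<noteq> 0" using False by (auto simp: blinfun.bilinear_simps)
    have ab: "a > 0" "b > 0" using x0 False by (auto simp: a_def b_def y_def)
    have yF: "inner y f = 0" if "f \<in> F" for f
      using x that by (simp add: y_def symmetric_opD[OF D])
    have Dy: "inner (blinfun_apply D y) x = b\<^sup>2"
      using symmetric_opD[OF D, of y x] by (simp add: y_def b_def power2_norm_eq_inner)
    have xy: "inner y y = b\<^sup>2" "inner x x = a\<^sup>2" by (simp_all add: a_def b_def power2_norm_eq_inner)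
    \<comment> \<open>Used at \<open>t = a\<close> and \<open>t = - a\<close>. Subtracting the two
      form values leaves only the cross term, and adding the two squared norms gives
      \<open>4 * a\<^sup>2 * b\<^sup>2\<close>; the weights \<open>b\<close> and \<open>a\<close>
      balance the norms of the two summands.\<close>
    have p: "inner (blinfun_apply D (b *\<^sub>R x + t *\<^sub>R y)) (b *\<^sub>R x + t *\<^sub>R y)
        = b\<^sup>2 * inner y x + 2 * t * b * b\<^sup>2 + t\<^sup>2 * inner (blinfun_apply D y) y" for t
      by (simp add: blinfun.bilinear_simps inner_add Dy xy power2_eq_square algebra_simps flip: y_def)
    have n: "(norm (b *\<^sub>R x + t *\<^sub>R y))\<^sup>2 = b\<^sup>2 * a\<^sup>2 + 2 * t * b * inner x y + t\<^sup>2 * b\<^sup>2" for t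
      by (simp add: power2_norm_eq_inner inner_add xy inner_commute)
        (simp add: power2_eq_square algebra_simps)
    have bd: "\<bar>inner (blinfun_apply D (b *\<^sub>R x + t *\<^sub>R y)) (b *\<^sub>R x + t *\<^sub>R y)\<bar>
        \<le> \<epsilon> * (norm (b *\<^sub>R x + t *\<^sub>R y))\<^sup>2" for t
      using x yF by (intro F(2)) (auto simp: inner_add_left)
    have "P - Q \<le> u + v" if "\<bar>P\<bar> \<le> u" "\<bar>Q\<bar> \<le> v" for P Q u v :: real
      using that by linarith
    from this[OF bd[of a] bd[of "-a"]] have "4 * a * b * b\<^sup>2 \<le> \<epsilon> * (4 * a\<^sup>2 * b\<^sup>2)"
      unfolding p n by (simp add: algebra_simps)
    then have "(4 * a * b\<^sup>2) * b \<le> (4 * a * b\<^sup>2) * (\<epsilon> * a)" by (simp add: power2_eq_square mult_ac)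
    then have "b \<le> \<epsilon> * a" using ab by (subst (asm) mult_le_cancel_left_pos) auto
    then show ?thesis by (simp add: a_def b_def y_def)
  qed
  then show "\<exists>F. finite F \<and> (\<forall>x. (\<forall>f\<in>F. inner x f = 0) \<longrightarrow> norm (blinfun_apply D x) \<le> \<epsilon> * norm x)"
    using F(1) by (intro exI[of _ "F \<union> blinfun_apply D ` F"]) simp
qed

text \<open>For \<open>\<beta> > 0\<close> the factor \<open>A + \<beta>\<close> of \<open>A\<^sup>2 - \<beta>\<^sup>2\<close> is bounded below by \<open>\<beta>\<close>.\<close>

lemma positive_minus_scalar_small:
  assumes A: "positive_op A" and \<beta>: "\<beta> \<ge> 0"
    and q: "\<And>\<epsilon>. \<epsilon> > 0 \<Longrightarrow> \<exists>F. finite F \<and> (\<forall>x. (\<forall>f\<in>F. inner x f = 0) \<longrightarrow>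
      \<bar>(norm (blinfun_apply A x))\<^sup>2 - \<beta>\<^sup>2 * (norm x)\<^sup>2\<bar> \<le> \<epsilon> * (norm x)\<^sup>2)"
  shows "small_off_finite (A - \<beta> *\<^sub>R id_blinfun)"
proof (cases "\<beta> = 0")
  \<comment> \<open>No positive lower bound for \<open>A + \<beta>\<close> is available here; the
    hypothesis at \<open>\<epsilon>\<^sup>2\<close> gives the estimate directly.\<close>
  case True
  show ?thesis
    unfolding small_off_finite_def
  proof (intro allI impI)
    fix \<epsilon> :: real assume e: "\<epsilon> > 0"
    then have "\<exists>F. finite F \<and> (\<forall>x. (\<forall>f\<in>F. inner x f = 0) \<longrightarrow>
        (norm (blinfun_apply A x))\<^sup>2 \<le> \<epsilon>\<^sup>2 * (norm x)\<^sup>2)"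
      using q[of "\<epsilon>\<^sup>2"] True by simp
    then obtain F where F: "finite F \<and> (\<forall>x. (\<forall>f\<in>F. inner x f = 0) \<longrightarrow>
        (norm (blinfun_apply A x))\<^sup>2 \<le> \<epsilon>\<^sup>2 * (norm x)\<^sup>2)" ..
    have "norm (blinfun_apply A x) \<le> \<epsilon> * norm x" if "\<forall>f\<in>F. inner x f = 0" for x
    proof (rule power2_le_imp_le)
      show "(norm (blinfun_apply A x))\<^sup>2 \<le> (\<epsilon> * norm x)\<^sup>2"
        using F that unfolding power_mult_distrib by blast
    qed (use e in simp)
    then show "\<exists>F. finite F \<and> (\<forall>x. (\<forall>f\<in>F. inner x f = 0) \<longrightarrow>
        norm (blinfun_apply (A - \<beta> *\<^sub>R id_blinfun) x) \<le> \<epsilon> * norm x)"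
      unfolding True using F by (intro exI[of _ F]) simp
  qed
next
  case False
  then have \<beta>: "\<beta> > 0" using \<beta> by simp
  note s = symmetric_opD[OF positive_op_symmetric[OF A]]
  define D where "D = (A o\<^sub>L A) - \<beta>\<^sup>2 *\<^sub>R id_blinfun"
  have "small_off_finite D"
  proof (rule symmetric_small_off_finite)
    show "symmetric_op D" by (simp add: symmetric_op_def D_def blinfun.bilinear_simps inner_diff s)
    have "inner (blinfun_apply D x) x = (norm (blinfun_apply A x))\<^sup>2 - \<beta>\<^sup>2 * (norm x)\<^sup>2" for x
      by (simp add: D_def blinfun.bilinear_simps inner_diff s power2_norm_eq_inner)
    then show "\<exists>F. finite F \<and> (\<forall>x. (\<forall>f\<in>F. inner x f = 0) \<longrightarrow>
        \<bar>inner (blinfun_apply D x) x\<bar> \<le> \<epsilon> * (norm x)\<^sup>2)" if "\<epsilon> > 0" for \<epsilon>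
      using q[OF that] by simp
  qed
  moreover have le: "\<beta> * norm (blinfun_apply (A - \<beta> *\<^sub>R id_blinfun) x) \<le> norm (blinfun_apply D x)" for x
  proof -
    define y where "y = blinfun_apply (A - \<beta> *\<^sub>R id_blinfun) x"
    have "blinfun_apply D x = blinfun_apply A y + \<beta> *\<^sub>R y"
      by (simp add: D_def y_def blinfun.bilinear_simps power2_eq_square algebra_simps)
    then have "(norm (blinfun_apply D x))\<^sup>2
        = (norm (blinfun_apply A y))\<^sup>2 + 2 * \<beta> * inner (blinfun_apply A y) y + (\<beta> * norm y)\<^sup>2"
      by (simp add: power_mult_distrib power2_norm_eq_inner inner_add inner_commute)
        (simp add: power2_eq_square)
    then have "(\<beta> * norm y)\<^sup>2 \<le> (norm (blinfun_apply D x))\<^sup>2"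
      using positive_op_inner[OF A, of y] \<beta> by simp
    then show ?thesis unfolding y_def by (rule power2_le_imp_le) simp
  qed
  ultimately show ?thesis
    unfolding small_off_finite_def
  proof (intro allI impI)
    fix \<epsilon> :: real assume "\<epsilon> > 0" and D: "\<forall>\<epsilon>>0. \<exists>F. finite F \<and>
      (\<forall>x. (\<forall>f\<in>F. inner x f = 0) \<longrightarrow> norm (blinfun_apply D x) \<le> \<epsilon> * norm x)"
    then obtain F where F: "finite F"
      "\<And>x. (\<forall>f\<in>F. inner x f = 0) \<Longrightarrow> norm (blinfun_apply D x) \<le> (\<beta> * \<epsilon>) * norm x"
      using \<beta> by (metis mult_pos_pos)
    have "norm (blinfun_apply (A - \<beta> *\<^sub>R id_blinfun) x) \<le> \<epsilon> * norm x" if "\<forall>f\<in>F. inner x f = 0" for x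
    proof -
      have "\<beta> * norm (blinfun_apply (A - \<beta> *\<^sub>R id_blinfun) x) \<le> \<beta> * (\<epsilon> * norm x)"
        using order_trans[OF le F(2)[OF that]] by (simp add: mult.assoc)
      then show ?thesis using \<beta> by (subst (asm) mult_le_cancel_left_pos) auto
    qed
    then show "\<exists>F. finite F \<and> (\<forall>x. (\<forall>f\<in>F. inner x f = 0) \<longrightarrow>
        norm (blinfun_apply (A - \<beta> *\<^sub>R id_blinfun) x) \<le> \<epsilon> * norm x)"
      using F(1) by blast
  qed
qed

section \<open>Absolutely minimum attaining operators\<close>

text \<open>Spectrum-free form of an essential spectral bound: between infinite-dimensional Hilbert
  spaces, the infimum of such \<open>s\<close> is the bottom of the essential spectrum of the
  adjoint of \<open>T\<close> composed with \<open>T\<close>. In finite-dimensional domains no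
  \<open>s\<close> qualifies.\<close>

definition ess_below :: "('a::real_inner \<Rightarrow>\<^sub>L 'b::real_normed_vector) \<Rightarrow> real \<Rightarrow> bool" where
  "ess_below T s \<longleftrightarrow> (\<forall>F. finite F \<longrightarrow>
     (\<exists>u. norm u = 1 \<and> (\<forall>f\<in>F. inner u f = 0) \<and> (norm (blinfun_apply T u))\<^sup>2 \<le> s))"

definition ess_above :: "('a::real_inner \<Rightarrow>\<^sub>L 'b::real_normed_vector) \<Rightarrow> real \<Rightarrow> bool" where
  "ess_above T s \<longleftrightarrow> (\<forall>F. finite F \<longrightarrow>
     (\<exists>u. norm u = 1 \<and> (\<forall>f\<in>F. inner u f = 0) \<and> s \<le> (norm (blinfun_apply T u))\<^sup>2))"

text \<open>Take \<open>u\<close> of low value, then \<open>v\<close> of high value orthogonal to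
  \<open>u\<close> and to \<open>S (T u)\<close>, so that the images are orthogonal too. By
  Pythagoras the value at \<open>sqrt (1 - r) u + sqrt r v\<close> is affine in
  \<open>r\<close>.\<close>

lemma unit_vector_of_value:
  fixes T :: "'a::real_inner \<Rightarrow>\<^sub>L 'b::real_inner"
  assumes S: "\<And>x y. inner (blinfun_apply T x) y = inner x (blinfun_apply S y)"
    and below: "ess_below T c" and above: "ess_above T d"
    and t: "c \<le> t" "t \<le> d" "c < d" and F: "finite F"
  shows "\<exists>e. norm e = 1 \<and> (\<forall>f\<in>F. inner e f = 0) \<and> (norm (blinfun_apply T e))\<^sup>2 = t"
proof -
  obtain u where u: "norm u = 1" "\<forall>f\<in>F. inner u f = 0" "(norm (blinfun_apply T u))\<^sup>2 \<le> c"
    using below F unfolding ess_below_def by blast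
  have "finite (insert u (insert (blinfun_apply S (blinfun_apply T u)) F))" using F by simp
  with above obtain v where v: "norm v = 1" "\<forall>f\<in>F. inner v f = 0" "inner v u = 0"
    "inner v (blinfun_apply S (blinfun_apply T u)) = 0" "d \<le> (norm (blinfun_apply T v))\<^sup>2"
    unfolding ess_above_def by (metis insertCI)
  have Tvu: "inner (blinfun_apply T v) (blinfun_apply T u) = 0" using v(4) by (simp add: S)
  define p q where "p = (norm (blinfun_apply T u))\<^sup>2" and "q = (norm (blinfun_apply T v))\<^sup>2"
  have pq: "p \<le> t" "t \<le> q" "p < q" using u v t by (auto simp: p_def q_def)
  define r where "r = (t - p) / (q - p)"
  have "r * (q - p) = t - p" using pq by (simp add: r_def)
  then have r: "(1 - r) * p + r * q = t" by (simp add: algebra_simps)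
  have r01: "0 \<le> r" "r \<le> 1" using pq by (auto simp: r_def)
  define e where "e = sqrt (1 - r) *\<^sub>R u + sqrt r *\<^sub>R v"
  have "(norm e)\<^sup>2 = (1 - r) * (norm u)\<^sup>2 + r * (norm v)\<^sup>2"
    using r01 v(3) norm_add_Pythagorean[of "sqrt (1 - r) *\<^sub>R u" "sqrt r *\<^sub>R v"]
    by (simp add: e_def orthogonal_def inner_commute power_mult_distrib)
  then have "(norm e)\<^sup>2 = 1" using u v by simp
  then have "norm e = 1" by (simp add: power2_norm_eq_inner norm_eq_1)
  moreover have "(norm (blinfun_apply T e))\<^sup>2 = t"
    using r r01 Tvu norm_add_Pythagorean[of "sqrt (1 - r) *\<^sub>R blinfun_apply T u" "sqrt r *\<^sub>R blinfun_apply T v"]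
    by (simp add: e_def orthogonal_def inner_commute power_mult_distrib blinfun.bilinear_simps
        flip: p_def q_def)
  moreover have "\<forall>f\<in>F. inner e f = 0" using u v by (simp add: e_def inner_add_left)
  ultimately show ?thesis by blast
qed

lemma subspace_closure:
  fixes S :: "'a::real_normed_vector set"
  assumes S: "subspace S" shows "subspace (closure S)"
  unfolding subspace_def
proof (intro conjI ballI allI)
  show "0 \<in> closure S" using subspace_0[OF S] closure_subset by blast
  fix x assume "x \<in> closure S"
  then obtain X where X: "\<And>n. X n \<in> S" "X \<longlonglongrightarrow> x" unfolding closure_sequential by blast
  show "c *\<^sub>R x \<in> closure S" for c
    unfolding closure_sequential using X subspace_scale[OF S]
    by (intro exI[of _ "\<lambda>n. c *\<^sub>R X n"]) (auto intro: tendsto_intros)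
  fix y assume "y \<in> closure S"
  then obtain Y where Y: "\<And>n. Y n \<in> S" "Y \<longlonglongrightarrow> y" unfolding closure_sequential by blast
  show "x + y \<in> closure S"
    unfolding closure_sequential using X Y subspace_add[OF S]
    by (intro exI[of _ "\<lambda>n. X n + Y n"]) (auto intro: tendsto_intros)
qed

text \<open>The form \<open>b(x, y) = \<langle>Tx, Ty\<rangle> - c \<langle>x, y\<rangle>\<close> is positive semidefinite on the closed span,
  so an isotropic \<open>x\<close> would satisfy \<open>b(x, g) = 0\<close>, hence \<open>\<langle>x, g\<rangle> = 0\<close>, for all \<open>g\<close> in \<open>G\<close>.\<close>

lemma norm_square_gt_on_closed_span:
  fixes T :: "'a::real_inner \<Rightarrow>\<^sub>L 'b::real_inner"
  assumes unit: "\<And>g. g \<in> G \<Longrightarrow> norm g = 1"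
    and orth: "\<And>g h. g \<in> G \<Longrightarrow> h \<in> G \<Longrightarrow> g \<noteq> h \<Longrightarrow> inner g h = 0"
    and orthT: "\<And>g h. g \<in> G \<Longrightarrow> h \<in> G \<Longrightarrow> g \<noteq> h \<Longrightarrow> inner (blinfun_apply T g) (blinfun_apply T h) = 0"
    and gt: "\<And>g. g \<in> G \<Longrightarrow> c < (norm (blinfun_apply T g))\<^sup>2"
    and x: "x \<in> closure (span G)" "x \<noteq> 0"
  shows "c * (norm x)\<^sup>2 < (norm (blinfun_apply T x))\<^sup>2"
proof -
  define b where "b x y = inner (blinfun_apply T x) (blinfun_apply T y) - c * inner x y" for x y
  have b_add: "b (x + y) z = b x z + b y z" "b z (x + y) = b z x + b z y"
    and b_scale: "b (r *\<^sub>R x) z = r * b x z" "b z (r *\<^sub>R x) = r * b z x"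
    and b_zero: "b 0 z = 0" for x y z r
    by (simp_all add: b_def blinfun.bilinear_simps inner_add algebra_simps)
  have b_sum: "b (\<Sum>i\<in>A. f i) z = (\<Sum>i\<in>A. b (f i) z)" "b z (\<Sum>i\<in>A. f i) = (\<Sum>i\<in>A. b z (f i))"
    for f :: "'a \<Rightarrow> 'a" and A z
    by (simp_all add: b_def blinfun.bilinear_simps inner_sum_left inner_sum_right sum_distrib_left
        sum_subtractf)
  have b_sym: "b x y = b y x" for x y by (simp add: b_def inner_commute)
  have bG: "b g h = 0" if "g \<in> G" "h \<in> G" "g \<noteq> h" for g h
    using orth orthT that by (simp add: b_def)
  have bgg: "b g g = (norm (blinfun_apply T g))\<^sup>2 - c" if "g \<in> G" for g
    using unit[OF that] by (simp add: b_def flip: power2_norm_eq_inner)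
  have b_span: "0 \<le> b y y" if y: "y \<in> span G" for y
  proof -
    obtain A r where A: "finite A" "A \<subseteq> G" and y_eq: "y = (\<Sum>a\<in>A. r a *\<^sub>R a)"
      using y unfolding span_explicit by blast
    have "b y y = (\<Sum>a\<in>A. \<Sum>a'\<in>A. r a * (r a' * b a a'))"
      unfolding y_eq b_sum b_scale by (simp add: sum_distrib_left b_sym)
    also have "\<dots> = (\<Sum>a\<in>A. \<Sum>a'\<in>A. if a' = a then r a * (r a * b a a) else 0)"
      using A bG by (intro sum.cong refl) auto
    also have "\<dots> = (\<Sum>a\<in>A. r a * (r a * b a a))"
      using A by simp
    also have "\<dots> \<ge> 0"
    proof (rule sum_nonneg)
      fix a assume "a \<in> A"
      then have "a \<in> G" using A(2) by blast
      then have "b a a \<ge> 0" using bgg[of a] gt[of a] by simp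
      then show "0 \<le> r a * (r a * b a a)" by (simp flip: mult.assoc)
    qed
    finally show ?thesis .
  qed
  have clos: "closed {y. 0 \<le> b y y}"
    unfolding b_def by (intro closed_Collect_le continuous_intros)
  have b_nonneg: "0 \<le> b y y" if "y \<in> closure (span G)" for y
    using closure_minimal[OF _ clos, of "span G"] b_span that by blast
  \<comment> \<open>Both sides are linear and continuous in \<open>y\<close> and agree on
    \<open>G\<close>. As \<open>b g g > 0\<close>, vanishing of \<open>b x g\<close> will mean
    orthogonality to \<open>g\<close>.\<close>
  have b_g: "b y g = b g g * inner y g" if "g \<in> G" "y \<in> closure (span G)" for g y
  proof -
    have "span G \<subseteq> {y. b y g = b g g * inner y g}"
    proof (rule span_minimal, rule subsetI)
      show "subspace {y. b y g = b g g * inner y g}"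
        by (auto simp: subspace_def b_add b_scale b_zero inner_add_left algebra_simps)
      fix h assume h: "h \<in> G"
      show "h \<in> {y. b y g = b g g * inner y g}"
        using bG[OF h \<open>g \<in> G\<close>] orth[OF h \<open>g \<in> G\<close>] unit[OF \<open>g \<in> G\<close>]
        by (cases "h = g") (auto simp flip: power2_norm_eq_inner)
    qed
    moreover have "closed {y. b y g = b g g * inner y g}"
      unfolding b_def by (intro closed_Collect_eq continuous_intros)
    ultimately show ?thesis using closure_minimal \<open>y \<in> closure (span G)\<close> by blast
  qed
  \<comment> \<open>Passing to the closure keeps only the weak inequality; strictness needs a
    separate argument.\<close>
  have "b x x \<noteq> 0"
  proof
    assume bx: "b x x = 0"
    have xg: "inner x g = 0" if g: "g \<in> G" for g
    proof -
      have "2 * b x g = 0"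
      proof (rule linear_coeff_zero)
        fix t
        have "t *\<^sub>R g \<in> closure (span G)"
          using span_base[OF g] span_scale closure_subset by blast
        then have "x + t *\<^sub>R g \<in> closure (span G)"
          using x(1) subspace_closure[OF subspace_span] subspace_add by blast
        then have "0 \<le> b (x + t *\<^sub>R g) (x + t *\<^sub>R g)" by (rule b_nonneg)
        then show "0 \<le> t * (2 * b x g) + t\<^sup>2 * b g g"
          by (simp add: b_add b_scale bx b_sym[of g x] power2_eq_square algebra_simps)
      qed
      then show ?thesis using b_g[OF g x(1)] bgg[OF g] gt[OF g] by simp
    qed
    have "span G \<subseteq> {y. inner x y = 0}"
      by (rule span_minimal) (auto simp: subspace_def inner_add_right xg)
    moreover have "closed {y. inner x y = 0}" by (intro closed_Collect_eq continuous_intros)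
    ultimately have "inner x x = 0" using closure_minimal x(1) by blast
    then show False using x(2) by simp
  qed
  then have "0 < b x x" using b_nonneg[OF x(1)] by simp
  then show ?thesis by (simp add: b_def power2_norm_eq_inner)
qed

text \<open>Lets real spans be used as test subspaces for \<open>AM_ops\<close>, which quantifies
  over complex ones.\<close>

lemma csubspace_closure_span:
  fixes G :: "'a::complex_inner set"
  assumes "\<And>g. g \<in> G \<Longrightarrow> \<i> *\<^sub>C g \<in> span G"
  shows "csubspace (closure (span G))"
proof -
  have sub: "subspace (closure (span G))" by (rule subspace_closure) (rule subspace_span)
  interpret i: bounded_linear "\<lambda>x::'a. \<i> *\<^sub>C x" by (rule bounded_linear_i)
  have "subspace {y. \<i> *\<^sub>C y \<in> span G}"
    by (auto simp: subspace_def i.zero i.add i.scaleR span_zero span_add span_scale)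
  then have "span G \<subseteq> {y. \<i> *\<^sub>C y \<in> span G}"
    using assms by (intro span_minimal) auto
  moreover have "closed {y::'a. \<i> *\<^sub>C y \<in> closure (span G)}"
    using closed_vimage[OF closed_closure i.continuous_on[OF continuous_on_id], of "span G"]
    by (simp add: vimage_def)
  ultimately have "closure (span G) \<subseteq> {y. \<i> *\<^sub>C y \<in> closure (span G)}"
    using closure_subset[of "span G"] by (intro closure_minimal) auto
  then have "c *\<^sub>C y \<in> closure (span G)" if "y \<in> closure (span G)" for c y
    using that sub by (subst scaleC_decompose) (auto intro: subspace_add subspace_scale)
  then show ?thesis using sub by (auto simp: csubspace_def subspace_0 subspace_add)
qed

text \<open>A recursive choice controls each vector only against earlier ones; symmetry of
  \<open>inner\<close> and skew-symmetry of \<open>\<i>\<close> supply the other direction.\<close>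

lemma orthogonal_i_family:
  fixes f :: "nat \<Rightarrow> 'a::complex_inner"
  assumes o: "\<And>m n. m < n \<Longrightarrow> inner (f n) (f m) = 0 \<and> inner (f n) (\<i> *\<^sub>C f m) = 0"
  shows "m \<noteq> n \<Longrightarrow> inner (f m) (f n) = 0" "inner (f m) (\<i> *\<^sub>C f n) = 0"
proof -
  show "inner (f m) (f n) = 0" if "m \<noteq> n"
    using that o[of m n] o[of n m] by (cases "m < n") (auto simp: inner_commute)
  show "inner (f m) (\<i> *\<^sub>C f n) = 0"
  proof (cases m n rule: linorder_cases)
    case less
    then show ?thesis using o[of m n] inner_i_left[of "f m" "f n"] by (simp add: inner_commute)
  qed (use o inner_i_self in auto)
qed

text \<open>Between an essential value below \<open>c\<close> and one above \<open>d\<close> every value in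
  \<open>[c, d]\<close> is attained off any finite set; unit vectors with values decreasing strictly to \<open>c\<close>
  then span a subspace on which the minimum is not attained.\<close>

lemma AM_ops_not_ess_gap:
  fixes T :: "'a::chilbert_space \<Rightarrow>\<^sub>L 'b::chilbert_space"
  assumes T: "T \<in> AM_ops" and cd: "c < d" and below: "ess_below T c" and above: "ess_above T d"
  shows False
proof -
  have Tb: "T \<in> bounded_ops" using T by (simp add: AM_ops_def)
  obtain S where S: "\<And>x y. inner (blinfun_apply T x) y = inner x (blinfun_apply S y)"
    using real_adjoint_exists[of T] by blast
  define Q where "Q x = blinfun_apply S (blinfun_apply T x)" for x
  \<comment> \<open>Prescribed values: \<open>t 0 = d\<close>, decreasing to \<open>c\<close>
    without reaching it.\<close>
  define t where "t n = c + (d - c) * inverse (real (Suc n))" for n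
  have t: "c < t n" "t n \<le> d" for n
  proof -
    have "inverse (real (Suc n)) \<le> 1" by (simp add: field_simps)
    then have "(d - c) * inverse (real (Suc n)) \<le> (d - c) * 1"
      using cd by (intro mult_left_mono) auto
    then have "t n \<le> c + (d - c)" unfolding t_def mult_1_right by (rule add_left_mono)
    then show "t n \<le> d" by simp
    show "c < t n" using cd by (simp add: t_def)
  qed
  \<comment> \<open>Orthogonality to \<open>y\<close> and \<open>\<i> *\<^sub>C y\<close> is complex
    orthogonality. The two values of \<open>Q\<close> impose the same on the images, since
    \<open>inner r (Q y) = inner (T r) (T y)\<close>.\<close>
  define N where "N y = {y, \<i> *\<^sub>C y, Q y, Q (\<i> *\<^sub>C y)}" for y
  define P where "P f n r \<longleftrightarrow> norm r = 1 \<and> (norm (blinfun_apply T r))\<^sup>2 = t n \<and>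
    (\<forall>m<n. \<forall>g\<in>N (f m). inner r g = 0)" for f n r
  have "\<exists>e. \<forall>n. P e n (e n)"
  proof (rule dependent_wellorder_choice)
    show "P f n r = P g n r" if "\<And>m. m < n \<Longrightarrow> f m = g m" for r f g n
      using that by (simp add: P_def)
    show "\<exists>r. P f n r" for n f
    proof -
      have "finite (\<Union>m<n. N (f m))" by (simp add: N_def)
      from unit_vector_of_value[OF S below above less_imp_le[OF t(1)] t(2) cd this]
      show ?thesis by (fastforce simp: P_def)
    qed
  qed
  then obtain e where "\<And>n. P e n (e n)" by blast
  then have e1: "norm (e n) = 1" and eT: "(norm (blinfun_apply T (e n)))\<^sup>2 = t n"
    and eo: "m < n \<Longrightarrow> g \<in> N (e m) \<Longrightarrow> inner (e n) g = 0" for m n g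
    by (auto simp: P_def)
  have ie1: "norm (\<i> *\<^sub>C e n) = 1" for n
    using e1[of n] by (simp add: norm_eq_sqrt_inner inner_i_i)
  have ieT: "(norm (blinfun_apply T (\<i> *\<^sub>C e n)))\<^sup>2 = t n" for n
    using eT[of n] by (simp add: power2_norm_eq_inner inner_i_i bounded_opsD[OF Tb])
  have o1: "inner (e n) (e m) = 0 \<and> inner (e n) (\<i> *\<^sub>C e m) = 0" if "m < n" for m n
    using eo[OF that] by (simp add: N_def)
  have o2: "inner (blinfun_apply T (e n)) (blinfun_apply T (e m)) = 0
      \<and> inner (blinfun_apply T (e n)) (\<i> *\<^sub>C blinfun_apply T (e m)) = 0" if "m < n" for m n
    using eo[OF that] by (simp add: N_def S Q_def flip: bounded_opsD[OF Tb])
  define G where "G = range e \<union> range (\<lambda>n. \<i> *\<^sub>C e n)"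
  note orth = orthogonal_i_family[of e, OF o1] orthogonal_i_family[of "\<lambda>n. blinfun_apply T (e n)", OF o2]
  have G_orth: "inner g h = 0 \<and> inner (blinfun_apply T g) (blinfun_apply T h) = 0"
    if "g \<in> G" "h \<in> G" "g \<noteq> h" for g h
    using that unfolding G_def
    by (auto simp: bounded_opsD[OF Tb] inner_i_i inner_i_left orth intro!: orth)
  define M where "M = closure (span G)"
  have GM: "g \<in> M" if "g \<in> G" for g
    using span_base[OF that] closure_subset by (auto simp: M_def)
  have gt: "c < (norm (blinfun_apply T x))\<^sup>2" if "x \<in> M" "norm x = 1" for x
  proof -
    have "c * (norm x)\<^sup>2 < (norm (blinfun_apply T x))\<^sup>2"
    proof (rule norm_square_gt_on_closed_span)
      show "x \<in> closure (span G)" "x \<noteq> 0" using that by (auto simp: M_def)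
      show "norm g = 1" "c < (norm (blinfun_apply T g))\<^sup>2" if "g \<in> G" for g
        using that t(1) by (auto simp: G_def e1 ie1 eT ieT)
    qed (use G_orth in auto)
    then show ?thesis using that by simp
  qed
  have "csubspace M"
    unfolding M_def
  proof (rule csubspace_closure_span)
    show "\<i> *\<^sub>C g \<in> span G" if "g \<in> G" for g
      using that by (auto simp: G_def span_base intro!: span_neg)
  qed
  moreover have "closed M" by (simp add: M_def)
  moreover have "M \<noteq> {0}"
  proof
    assume "M = {0}"
    moreover have "e 0 \<in> M" by (rule GM) (simp add: G_def)
    ultimately show False using e1[of 0] by simp
  qed
  ultimately have "minimum_attaining_on M T" using T by (simp add: AM_ops_def)
  then obtain x where x: "x \<in> M" "norm x = 1" "norm (blinfun_apply T x) = min_modulus_on M T"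
    unfolding minimum_attaining_on_def by blast
  \<comment> \<open>Chosen so that \<open>inverse (Suc n) < \<delta>\<close> says exactly that
    \<open>t n\<close> lies below the allegedly minimal value.\<close>
  define \<delta> where "\<delta> = ((norm (blinfun_apply T x))\<^sup>2 - c) / (d - c)"
  have "\<delta> > 0" using gt[OF x(1,2)] cd by (simp add: \<delta>_def)
  then obtain n where "inverse (real (Suc n)) < \<delta>" using reals_Archimedean by blast
  then have "t n < (norm (blinfun_apply T x))\<^sup>2"
    using cd by (simp add: t_def \<delta>_def field_simps)
  then have "norm (blinfun_apply T (e n)) < norm (blinfun_apply T x)"
    using eT[of n] by (metis norm_ge_zero power_less_imp_less_base)
  moreover have "min_modulus_on M T \<le> norm (blinfun_apply T (e n))"
    unfolding min_modulus_on_def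
    by (rule cInf_lower) (use GM e1 in \<open>auto simp: G_def intro: bdd_belowI[of _ 0]\<close>)
  ultimately show False using x(3) by simp
qed

section \<open>Passage to the norm closure\<close>

lemma norm_square_blinfun_close:
  assumes "norm (S - T) \<le> \<eta>" "norm S + norm T \<le> b" "norm x = 1"
  shows "\<bar>(norm (blinfun_apply S x))\<^sup>2 - (norm (blinfun_apply T x))\<^sup>2\<bar> \<le> \<eta> * b"
proof -
  define p q where "p = norm (blinfun_apply S x)" and "q = norm (blinfun_apply T x)"
  have "\<bar>p - q\<bar> \<le> norm (blinfun_apply (S - T) x)"
    unfolding p_def q_def blinfun.diff_left by (rule norm_triangle_ineq3)
  also have "\<dots> \<le> \<eta>" using norm_blinfun[of "S - T" x] assms by simp
  finally have 1: "\<bar>p - q\<bar> \<le> \<eta>" .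
  have 2: "p + q \<le> b" "0 \<le> p + q" using norm_blinfun[of S x] norm_blinfun[of T x] assms
    by (auto simp: p_def q_def)
  have "\<bar>p\<^sup>2 - q\<^sup>2\<bar> = \<bar>p - q\<bar> * (p + q)"
    using 2(2) by (simp add: power2_eq_square square_diff_square_factored abs_mult)
  also have "\<dots> \<le> \<eta> * b" using 1 2 by (intro mult_mono) auto
  finally show ?thesis by (simp add: p_def q_def)
qed

text \<open>A nearby \<open>R\<close> in \<open>AM_ops\<close> changes squared norms on unit vectors
  by at most a third of \<open>d - c\<close>, so it still has a gap a third as wide.\<close>

lemma closure_AM_ops_not_ess_gap:
  fixes T :: "'a::chilbert_space \<Rightarrow>\<^sub>L 'b::chilbert_space"
  assumes T: "T \<in> closure AM_ops" and cd: "c < d"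
    and below: "ess_below T c" and above: "ess_above T d"
  shows False
proof -
  \<comment> \<open>Bounds \<open>norm R + norm T\<close> once \<open>R\<close> is within distance 1
    of \<open>T\<close>; hence the minimum with 1 in \<open>\<eta>\<close>.\<close>
  define b where "b = 2 * norm T + 1"
  have b: "b > 0" by (simp add: b_def add_nonneg_pos)
  define \<eta> where "\<eta> = min 1 ((d - c) / (3 * b))"
  have \<eta>: "\<eta> > 0" "\<eta> \<le> 1" "\<eta> * b \<le> (d - c) / 3"
    using cd b by (auto simp: \<eta>_def min_def field_simps)
  obtain R where R: "R \<in> AM_ops" "dist R T < \<eta>"
    using T \<eta>(1) unfolding closure_approachable by blast
  have RT: "norm (R - T) \<le> \<eta>" using R(2) by (simp add: dist_norm)
  have "norm R \<le> norm T + 1"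
    using norm_triangle_sub[of R T] RT \<eta>(2) by linarith
  then have b': "norm R + norm T \<le> b" by (simp add: b_def)
  have close: "\<bar>(norm (blinfun_apply R x))\<^sup>2 - (norm (blinfun_apply T x))\<^sup>2\<bar> \<le> (d - c) / 3" if "norm x = 1" for x
    using norm_square_blinfun_close[OF RT b' that] \<eta>(3) by linarith
  have "ess_below R (c + (d - c) / 3)"
    unfolding ess_below_def
  proof (intro allI impI)
    fix F :: "'a set" assume "finite F"
    then obtain u where u: "norm u = 1" "\<forall>f\<in>F. inner u f = 0" "(norm (blinfun_apply T u))\<^sup>2 \<le> c"
      using below unfolding ess_below_def by blast
    have "(norm (blinfun_apply R u))\<^sup>2 \<le> c + (d - c) / 3" using close[OF u(1)] u(3) by linarith
    with u show "\<exists>u. norm u = 1 \<and> (\<forall>f\<in>F. inner u f = 0) \<and> (norm (blinfun_apply R u))\<^sup>2 \<le> c + (d - c) / 3"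
      by blast
  qed
  moreover have "ess_above R (d - (d - c) / 3)"
    unfolding ess_above_def
  proof (intro allI impI)
    fix F :: "'a set" assume "finite F"
    then obtain u where u: "norm u = 1" "\<forall>f\<in>F. inner u f = 0" "d \<le> (norm (blinfun_apply T u))\<^sup>2"
      using above unfolding ess_above_def by blast
    have "d - (d - c) / 3 \<le> (norm (blinfun_apply R u))\<^sup>2" using close[OF u(1)] u(3) by linarith
    with u show "\<exists>u. norm u = 1 \<and> (\<forall>f\<in>F. inner u f = 0) \<and> d - (d - c) / 3 \<le> (norm (blinfun_apply R u))\<^sup>2"
      by blast
  qed
  moreover have "c + (d - c) / 3 < d - (d - c) / 3" using cd by (simp add: field_simps)
  ultimately show False using AM_ops_not_ess_gap[OF R(1)] by blast
qed

text \<open>Take \<open>\<beta>\<^sup>2\<close> as the infimum of the essential lower values.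
  Slightly below it \<open>ess_below\<close> fails by minimality; slightly above it
  \<open>ess_above\<close> fails because there is no gap. Each failure supplies a finite
  set.\<close>

lemma closure_AM_ops_ess_value:
  fixes T :: "'a::chilbert_space \<Rightarrow>\<^sub>L 'b::chilbert_space"
  assumes T: "T \<in> closure AM_ops"
  shows "\<exists>\<beta>\<ge>0. \<forall>\<epsilon>>0. \<exists>F. finite F \<and> (\<forall>x. (\<forall>f\<in>F. inner x f = 0) \<longrightarrow>
    \<bar>(norm (blinfun_apply T x))\<^sup>2 - \<beta>\<^sup>2 * (norm x)\<^sup>2\<bar> \<le> \<epsilon> * (norm x)\<^sup>2)"
proof (cases "\<exists>F::'a set. finite F \<and> (\<forall>u. norm u = 1 \<longrightarrow> \<not> (\<forall>f\<in>F. inner u f = 0))")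
  \<comment> \<open>Finite dimension, including the zero space: only 0 is orthogonal to
    \<open>F\<close>, so the estimate is trivial and 0 is a default for
    \<open>\<beta>\<close>.\<close>
  case True
  then obtain F :: "'a set" where F: "finite F" "\<And>u. norm u = 1 \<Longrightarrow> \<not> (\<forall>f\<in>F. inner u f = 0)"
    by blast
  have "x = 0" if "\<forall>f\<in>F. inner x f = 0" for x
    using F(2)[of "x /\<^sub>R norm x"] that by (cases "x = 0") auto
  then have "\<forall>x. (\<forall>f\<in>F. inner x f = 0) \<longrightarrow>
    \<bar>(norm (blinfun_apply T x))\<^sup>2 - 0\<^sup>2 * (norm x)\<^sup>2\<bar> \<le> \<epsilon> * (norm x)\<^sup>2" for \<epsilon>
    by fastforce
  then show ?thesis using F(1) by (intro exI[of _ 0]) blast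
next
  case False
  define L where "L = {s. ess_below T s}"
  have L0: "0 \<le> s" if s: "s \<in> L" for s
  proof -
    obtain u where "(norm (blinfun_apply T u))\<^sup>2 \<le> s"
      using s unfolding L_def mem_Collect_eq ess_below_def by (meson finite.emptyI)
    then show ?thesis by (rule order_trans[OF zero_le_power2])
  qed
  have "(norm T)\<^sup>2 \<in> L"
    unfolding L_def ess_below_def mem_Collect_eq
  proof (intro allI impI)
    fix F :: "'a set" assume "finite F"
    then obtain u where u: "norm u = 1" "\<forall>f\<in>F. inner u f = 0" using False by blast
    have "norm (blinfun_apply T u) \<le> norm T" using norm_blinfun[of T u] u by simp
    then have "(norm (blinfun_apply T u))\<^sup>2 \<le> (norm T)\<^sup>2" by (simp add: power_mono)
    with u show "\<exists>u. norm u = 1 \<and> (\<forall>f\<in>F. inner u f = 0) \<and> (norm (blinfun_apply T u))\<^sup>2 \<le> (norm T)\<^sup>2"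
      by blast
  qed
  then have ne: "L \<noteq> {}" by blast
  have bdd: "bdd_below L" using L0 by (rule bdd_belowI)
  define \<beta> where "\<beta> = sqrt (Inf L)"
  have "0 \<le> Inf L" using ne L0 by (rule cInf_greatest)
  then have \<beta>: "\<beta> \<ge> 0" "\<beta>\<^sup>2 = Inf L" by (auto simp: \<beta>_def)
  show ?thesis
  proof (intro exI[of _ \<beta>] conjI allI impI \<beta>(1))
    fix \<epsilon> :: real assume e: "\<epsilon> > 0"
    have "Inf L - \<epsilon> \<notin> L" using cInf_lower[OF _ bdd, of "Inf L - \<epsilon>"] e by auto
    then have "\<not> ess_below T (Inf L - \<epsilon>)" by (metis L_def mem_Collect_eq)
    then obtain F1 where F1: "finite F1"
      "\<And>u. norm u = 1 \<Longrightarrow> \<forall>f\<in>F1. inner u f = 0 \<Longrightarrow> Inf L - \<epsilon> < (norm (blinfun_apply T u))\<^sup>2"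
      unfolding ess_below_def by (meson not_le)
    \<comment> \<open>The infimum need not be attained, so a member of \<open>L\<close> strictly
      below \<open>Inf L + \<epsilon>\<close> provides the lower end of the gap.\<close>
    obtain s where s: "s \<in> L" "s < Inf L + \<epsilon>" using cInf_lessD[OF ne, of "Inf L + \<epsilon>"] e by auto
    have "\<not> ess_above T (Inf L + \<epsilon>)"
      using closure_AM_ops_not_ess_gap[OF T s(2)] s(1) by (auto simp: L_def)
    then obtain F2 where F2: "finite F2"
      "\<And>u. norm u = 1 \<Longrightarrow> \<forall>f\<in>F2. inner u f = 0 \<Longrightarrow> (norm (blinfun_apply T u))\<^sup>2 < Inf L + \<epsilon>"
      unfolding ess_above_def by (meson not_le)
    have "\<bar>(norm (blinfun_apply T x))\<^sup>2 - \<beta>\<^sup>2 * (norm x)\<^sup>2\<bar> \<le> \<epsilon> * (norm x)\<^sup>2"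
      if x: "\<forall>f\<in>F1 \<union> F2. inner x f = 0" for x
    proof (cases "x = 0")
      case True
      then show ?thesis by (simp add: blinfun.bilinear_simps)
    next
      case False
      define u where "u = x /\<^sub>R norm x"
      have u: "norm u = 1" "\<forall>f\<in>F1. inner u f = 0" "\<forall>f\<in>F2. inner u f = 0"
        using False x by (auto simp: u_def)
      have xu: "x = norm x *\<^sub>R u" using False by (simp add: u_def)
      have "norm (blinfun_apply T x) = norm x * norm (blinfun_apply T u)"
        by (subst xu) (simp add: blinfun.bilinear_simps)
      then have "(norm (blinfun_apply T x))\<^sup>2 - \<beta>\<^sup>2 * (norm x)\<^sup>2
          = ((norm (blinfun_apply T u))\<^sup>2 - \<beta>\<^sup>2) * (norm x)\<^sup>2"
        by (simp add: power_mult_distrib algebra_simps)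
      moreover have "\<bar>(norm (blinfun_apply T u))\<^sup>2 - \<beta>\<^sup>2\<bar> \<le> \<epsilon>"
        using F1(2)[OF u(1,2)] F2(2)[OF u(1,3)] by (simp add: \<beta>(2) abs_le_iff)
      ultimately show ?thesis by (simp add: abs_mult mult_right_mono)
    qed
    then show "\<exists>F. finite F \<and> (\<forall>x. (\<forall>f\<in>F. inner x f = 0) \<longrightarrow>
        \<bar>(norm (blinfun_apply T x))\<^sup>2 - \<beta>\<^sup>2 * (norm x)\<^sup>2\<bar> \<le> \<epsilon> * (norm x)\<^sup>2)"
      using F1(1) F2(1) by (intro exI[of _ "F1 \<union> F2"]) blast
  qed
qed

theorem theorem6p6:
  fixes T W :: "'a::chilbert_space \<Rightarrow>\<^sub>L 'b::chilbert_space"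
  assumes "T \<in> closure AM_ops"
    and "polar_decomposition T W"
  shows "\<exists>K \<in> compact_ops. \<exists>\<beta>::real. \<beta> \<ge> 0 \<and> T = \<beta> *\<^sub>R W + K"
proof -
  have "AM_ops \<subseteq> (bounded_ops :: ('a \<Rightarrow>\<^sub>L 'b) set)" by (auto simp: AM_ops_def)
  then have Tb: "T \<in> bounded_ops" using bounded_ops_closure assms(1) by blast
  have Wb: "W \<in> bounded_ops" and TW: "T = W o\<^sub>L op_abs T"
    using assms(2) by (auto simp: polar_decomposition_def partial_isometry_def)
  note abs = op_abs_props[OF Tb]
  obtain \<beta> where \<beta>: "\<beta> \<ge> 0" and small: "\<And>\<epsilon>. \<epsilon> > 0 \<Longrightarrow> \<exists>F. finite F \<and> (\<forall>x. (\<forall>f\<in>F. inner x f = 0) \<longrightarrow>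
      \<bar>(norm (blinfun_apply T x))\<^sup>2 - \<beta>\<^sup>2 * (norm x)\<^sup>2\<bar> \<le> \<epsilon> * (norm x)\<^sup>2)"
    using closure_AM_ops_ess_value[OF assms(1)] by blast
  have "small_off_finite (op_abs T - \<beta> *\<^sub>R id_blinfun)"
    \<comment> \<open>The estimate for \<open>T\<close> transfers because \<open>op_abs T\<close>
      has the same norm at every vector.\<close>
    by (rule positive_minus_scalar_small[OF abs(1) \<beta>]) (simp only: abs(2) small)
  then have "small_off_finite (W o\<^sub>L (op_abs T - \<beta> *\<^sub>R id_blinfun))"
    by (rule small_off_finite_compose)
  moreover have "W o\<^sub>L (op_abs T - \<beta> *\<^sub>R id_blinfun) = T - \<beta> *\<^sub>R W"
  proof (rule blinfun_eqI)
    fix x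
    have "blinfun_apply T x = blinfun_apply W (blinfun_apply (op_abs T) x)"
      using TW by (metis blinfun_apply_blinfun_compose)
    then show "blinfun_apply (W o\<^sub>L (op_abs T - \<beta> *\<^sub>R id_blinfun)) x = blinfun_apply (T - \<beta> *\<^sub>R W) x"
      by (simp add: blinfun.bilinear_simps)
  qed
  ultimately have "compact (closure (blinfun_apply (T - \<beta> *\<^sub>R W) ` cball 0 1))"
    using small_off_finite_compact by metis
  then have "T - \<beta> *\<^sub>R W \<in> compact_ops"
    by (simp add: compact_ops_def bounded_ops_diff bounded_ops_scaleR Tb Wb)
  then show ?thesis using \<beta> by (intro bexI[of _ "T - \<beta> *\<^sub>R W"] exI[of _ \<beta>]) auto
qed

end
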